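(* Let $f,g\in\mathrm{Diff}(\mathbb{C},0)$ be of infinite order, i.e. for every integer $k\ge1$ neither $f^k$ nor $g^k$ coincides with the identity on a neighborhood of $0$. Then there exists a $G_\delta$-dense set $\mathcal{H}\subset\mathrm{Diff}(\mathbb{C},0)$ (for the analytic topology) such that, whenever $h\in\mathcal{H}$, the group generated by $f$ and $h^{-1}\circ g\circ h$ in the group of germs $\mathrm{Diff}(\mathbb{C},0)$ is free; that is, every non-trivial reduced word $W(a,b)$ yields a local diffeomorphism $W(f,h^{-1}\circ g\circ h)$ that does not coincide with the identity on any neighborhood of $0$.
   Context: $\mathrm{Diff}(\mathbb{C},0)$ is the group of germs of holomorphic diffeomorphisms of $\mathbb{C}$ fixing $0$. $W(f,g)$ denotes the result of substituting $a=f$, $b=g$ in a reduced word in $a^{\pm1},b^{\pm1}$ and composing. Analytic topology: for $r>0$ and $h$ holomorphic near $0$, $\|h\|_r=\sup_{B(r)}|h|$ if $h$ extends holomorphically to the open disc $B(r)$ of radius $r$, and $+\infty$ otherwise; a basis of open sets is given by $\{g:\|g-f\|_r<\varepsilon\}$, $f\in\mathrm{Diff}(\mathbb{C},0)$, $r,\varepsilon>0$. A $G_\delta$-dense set is a countable intersection of open dense sets. *)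

theory Defs
  imports "HOL-Analysis.Analysis"
begin

text \<open>Germs at 0 are represented by functions complex => complex, considered up to
  the equivalence "coincide on some neighbourhood of 0".\<close>

definition germ_eq :: "(complex \<Rightarrow> complex) \<Rightarrow> (complex \<Rightarrow> complex) \<Rightarrow> bool" where
  "germ_eq f g \<longleftrightarrow> (\<exists>r>0. \<forall>z\<in>ball 0 r. f z = g z)"

definition Diff0 :: "(complex \<Rightarrow> complex) set" where
  "Diff0 = {f. (\<exists>r>0. f holomorphic_on ball 0 r) \<and> f 0 = 0 \<and> deriv f 0 \<noteq> 0}"

definition germ_inv :: "(complex \<Rightarrow> complex) \<Rightarrow> (complex \<Rightarrow> complex)" where
  "germ_inv h = (SOME k. germ_eq (k \<circ> h) id \<and> germ_eq (h \<circ> k) id)"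

definition extends_to :: "real \<Rightarrow> (complex \<Rightarrow> complex) \<Rightarrow> (complex \<Rightarrow> complex) \<Rightarrow> bool" where
  "extends_to r h H \<longleftrightarrow> H holomorphic_on ball 0 r \<and> germ_eq H h"

definition anorm :: "real \<Rightarrow> (complex \<Rightarrow> complex) \<Rightarrow> ereal" where
  "anorm r h = (if \<exists>H. extends_to r h H
      then (SUP z\<in>ball 0 r. ereal (cmod ((SOME H. extends_to r h H) z)))
      else \<infinity>)"

definition basic_open :: "(complex \<Rightarrow> complex) \<Rightarrow> real \<Rightarrow> real \<Rightarrow> (complex \<Rightarrow> complex) set" where
  "basic_open f r \<epsilon> = {g\<in>Diff0. anorm r (\<lambda>z. g z - f z) < ereal \<epsilon>}"

definition analytic_open :: "(complex \<Rightarrow> complex) set \<Rightarrow> bool" where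
  "analytic_open U \<longleftrightarrow> U \<subseteq> Diff0 \<and>
     (\<forall>g\<in>U. \<exists>f\<in>Diff0. \<exists>r>0. \<exists>\<epsilon>>0. g \<in> basic_open f r \<epsilon> \<and> basic_open f r \<epsilon> \<subseteq> U)"

definition analytic_dense :: "(complex \<Rightarrow> complex) set \<Rightarrow> bool" where
  "analytic_dense D \<longleftrightarrow> D \<subseteq> Diff0 \<and>
     (\<forall>V. analytic_open V \<and> V \<noteq> {} \<longrightarrow> V \<inter> D \<noteq> {})"

definition Gdelta_dense :: "(complex \<Rightarrow> complex) set \<Rightarrow> bool" where
  "Gdelta_dense H \<longleftrightarrow> (\<exists>U :: nat \<Rightarrow> (complex \<Rightarrow> complex) set.
      (\<forall>n. analytic_open (U n) \<and> analytic_dense (U n)) \<and> H = (\<Inter>n. U n))"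

text \<open>Words in a^{+-1}, b^{+-1}: a letter is (is_a, positive).\<close>
type_synonym letter = "bool \<times> bool"

definition inverse_letter :: "letter \<Rightarrow> letter" where
  "inverse_letter l = (fst l, \<not> snd l)"

fun reduced_word :: "letter list \<Rightarrow> bool" where
  "reduced_word (x # y # w) \<longleftrightarrow> y \<noteq> inverse_letter x \<and> reduced_word (y # w)"
| "reduced_word _ \<longleftrightarrow> True"

definition eval_letter :: "(complex \<Rightarrow> complex) \<Rightarrow> (complex \<Rightarrow> complex) \<Rightarrow> letter \<Rightarrow> (complex \<Rightarrow> complex)" where
  "eval_letter f g l = (let u = (if fst l then f else g) in if snd l then u else germ_inv u)"

fun eval_word :: "(complex \<Rightarrow> complex) \<Rightarrow> (complex \<Rightarrow> complex) \<Rightarrow> letter list \<Rightarrow> (complex \<Rightarrow> complex)" where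
  "eval_word f g [] = id"
| "eval_word f g (l # w) = eval_letter f g l \<circ> eval_word f g w"

definition infinite_order :: "(complex \<Rightarrow> complex) \<Rightarrow> bool" where
  "infinite_order f \<longleftrightarrow> (\<forall>k::nat. k \<ge> 1 \<longrightarrow> \<not> germ_eq (f ^^ k) id)"

end

theory Submission
  imports Defs "HOL-Complex_Analysis.Complex_Analysis"
begin

text \<open>There are countably many reduced words, so it suffices that each of them is non-trivial for an
  open and dense set of conjugators \<open>h\<close>. Collecting letters, a word is an alternating product of
  non-trivial germs \<open>\<phi>\<close> (powers of \<open>f\<close>) and \<open>h\<inverse> \<circ> \<psi> \<circ> h\<close> (\<open>\<psi>\<close> a power of \<open>g\<close>). Maps whose
  derivative is within \<open>\<bar>a\<bar> / 2\<close> of a fixed \<open>a \<noteq> 0\<close> on a fixed disc have inverses on a common disc, so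
  all the words can be evaluated near \<open>0\<close> on a disc independent of \<open>h\<close>; by the identity theorem a word
  is non-trivial iff it moves a point of that disc. Openness is then continuity of the evaluation
  in \<open>h\<close>. For density, small polynomial perturbations of \<open>h\<close> make all points of the orbit of some
  \<open>p\<close> under the successive syllables distinct.\<close>

section \<open>Germs\<close>

lemma germ_eq_iff_eventually: "germ_eq f g \<longleftrightarrow> (\<forall>\<^sub>F z in nhds 0. f z = g z)"
  by (auto simp: germ_eq_def eventually_nhds_metric dist_commute)

lemma germ_eq_refl [simp]: "germ_eq f f"
  by (simp add: germ_eq_iff_eventually)

lemma germ_eq_sym: "germ_eq f g \<Longrightarrow> germ_eq g f"
  by (simp add: germ_eq_iff_eventually eq_commute)

lemma germ_eq_trans [trans]:
  assumes "germ_eq f g" "germ_eq g h"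
  shows "germ_eq f h"
  using assms unfolding germ_eq_iff_eventually by eventually_elim simp

lemma germ_eq_at_0: "germ_eq f g \<Longrightarrow> f 0 = g 0"
  by (auto simp: germ_eq_def)

text \<open>Since \<open>g\<close> tends to 0 at 0, the neighbourhood on which \<open>f\<close> and
  \<open>f'\<close> agree pulls back along \<open>g\<close> to a neighbourhood of 0.\<close>

lemma germ_eq_compose:
  assumes "germ_eq f f'" "germ_eq g g'" "isCont g 0" "g 0 = 0"
  shows "germ_eq (f \<circ> g) (f' \<circ> g')"
proof -
  have "filterlim g (nhds 0) (nhds 0)"
    using assms(3,4) by (simp add: isCont_def tendsto_nhds_iff)
  then have "\<forall>\<^sub>F z in nhds 0. f (g z) = f' (g z)"
    using assms(1) unfolding germ_eq_iff_eventually by (rule eventually_compose_filterlim[rotated])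
  with assms(2) show ?thesis
    unfolding germ_eq_iff_eventually by eventually_elim simp
qed

lemma Diff0_iff: "f \<in> Diff0 \<longleftrightarrow> f analytic_on {0} \<and> f 0 = 0 \<and> deriv f 0 \<noteq> 0"
  by (auto simp: Diff0_def analytic_on_def)

lemma Diff0_isCont: "f \<in> Diff0 \<Longrightarrow> isCont f 0"
  by (auto simp: Diff0_iff intro: analytic_at_imp_isCont)

lemma Diff0_0: "f \<in> Diff0 \<Longrightarrow> f 0 = 0"
  by (simp add: Diff0_def)

lemma Diff0_germ_eq: "f \<in> Diff0 \<Longrightarrow> germ_eq f g \<Longrightarrow> g \<in> Diff0"
  using analytic_at_cong[of f g 0 0] deriv_cong_ev[of f g 0 0] germ_eq_at_0[of f g]
  by (auto simp: Diff0_iff germ_eq_iff_eventually)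

lemma Diff0_id [simp]: "id \<in> Diff0"
  by (auto simp: Diff0_iff analytic_on_id)

lemma Diff0_compose: "f \<in> Diff0 \<Longrightarrow> g \<in> Diff0 \<Longrightarrow> f \<circ> g \<in> Diff0"
  using analytic_on_compose[of g "{0}" f] deriv_chain[of g 0 f]
  by (auto simp: Diff0_iff analytic_on_imp_differentiable_at)

lemma Diff0_funpow: "f \<in> Diff0 \<Longrightarrow> f ^^ n \<in> Diff0"
  by (induction n) (auto simp: Diff0_compose)

lemma germ_eq_compose_Diff0:
  "germ_eq f f' \<Longrightarrow> germ_eq g g' \<Longrightarrow> g \<in> Diff0 \<Longrightarrow> germ_eq (f \<circ> g) (f' \<circ> g')"
  by (intro germ_eq_compose Diff0_isCont Diff0_0)

text \<open>Identity theorem on a disc. It later turns triviality of a germ into a condition at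
  every point of a disc fixed in advance.\<close>

lemma germ_eq_imp_eq_on_ball:
  assumes "f holomorphic_on ball 0 r" "g holomorphic_on ball 0 r" "germ_eq f g" "z \<in> ball 0 r"
  shows "f z = g z"
proof -
  obtain s where s: "s > 0" "\<And>z. z \<in> ball 0 s \<Longrightarrow> f z = g z"
    using assms(3) by (auto simp: germ_eq_def)
  have r: "r > 0"
    using assms(4) le_less_trans[OF norm_ge_zero] by auto
  show ?thesis
  proof (rule analytic_continuation_open[of "ball 0 (min r s)" "ball 0 r" f g z])
  qed (use assms s r in auto)
qed

section \<open>Maps close to a linear map\<close>

text \<open>The reference slope \<open>a\<close> is a parameter rather than
  \<open>deriv h 0\<close>, so that \<open>h\<close> and its small perturbations satisfy the
  predicate with the same \<open>a\<close> and \<open>R\<close>. The bounds derived from it depend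
  only on these two constants.\<close>

definition near_linear :: "complex \<Rightarrow> real \<Rightarrow> (complex \<Rightarrow> complex) \<Rightarrow> bool" where
  "near_linear a R h \<longleftrightarrow> h holomorphic_on ball 0 R \<and> h 0 = 0 \<and>
     (\<forall>z\<in>ball 0 R. cmod (deriv h z - a) \<le> cmod a / 2)"

text \<open>The map \<open>h z - a * z\<close> has derivative at most \<open>cmod a / 2\<close> in
  modulus on a convex disc, hence is Lipschitz with that constant; the triangle inequality then
  gives both bounds.\<close>

lemma near_linear_lipschitz:
  assumes "near_linear a R h" "z \<in> ball 0 R" "w \<in> ball 0 R"
  shows "cmod (h z - h w) \<le> 3 / 2 * cmod a * cmod (z - w)"
    and "cmod a / 2 * cmod (z - w) \<le> cmod (h z - h w)"
proof -
  have "(h has_field_derivative deriv h x) (at x within ball 0 R)" if "x \<in> ball 0 R" for x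
    using assms(1) that unfolding near_linear_def
    by (meson holomorphic_derivI open_ball)
  then have *: "cmod ((h z - a * z) - (h w - a * w)) \<le> cmod a / 2 * cmod (z - w)"
    using assms unfolding near_linear_def
    by (intro field_differentiable_bound[where S = "ball 0 R" and f' = "\<lambda>x. deriv h x - a"])
       (auto intro!: derivative_eq_intros)
  have eq: "(h z - a * z) - (h w - a * w) = (h z - h w) - a * (z - w)"
    by (simp add: algebra_simps)
  have n: "cmod (a * (z - w)) = cmod a * cmod (z - w)"
    by (simp add: norm_mult)
  show "cmod (h z - h w) \<le> 3 / 2 * cmod a * cmod (z - w)"
    using * norm_triangle_ineq2[of "h z - h w" "a * (z - w)"] unfolding eq n by simp
  show "cmod a / 2 * cmod (z - w) \<le> cmod (h z - h w)"
    using * norm_triangle_ineq2[of "a * (z - w)" "h z - h w"] unfolding eq n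
    by (simp add: norm_minus_commute)
qed

lemma near_linear_bound:
  assumes "near_linear a R h" "z \<in> ball 0 R"
  shows "cmod (h z) \<le> 3 / 2 * cmod a * cmod z" "cmod a / 2 * cmod z \<le> cmod (h z)"
proof -
  have "0 \<in> ball 0 R"
    using assms(2) norm_ge_zero[of z] by (auto simp del: norm_ge_zero)
  then show "cmod (h z) \<le> 3 / 2 * cmod a * cmod z" "cmod a / 2 * cmod z \<le> cmod (h z)"
    using near_linear_lipschitz[OF assms, of 0] assms(1) by (auto simp: near_linear_def)
qed

lemma near_linear_inj_on:
  assumes "near_linear a R h" "a \<noteq> 0"
  shows "inj_on h (ball 0 R)"
proof (rule inj_onI)
  fix x y assume "x \<in> ball 0 R" "y \<in> ball 0 R" "h x = h y"
  then show "x = y"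
    using near_linear_lipschitz(2)[OF assms(1), of x y] assms(2) by (auto simp: mult_le_0_iff)
qed

lemma near_linear_image:
  assumes h: "near_linear a R h" and "a \<noteq> 0"
  shows "ball 0 (cmod a * R / 2) \<subseteq> h ` ball 0 R"
proof
  fix y :: complex assume y: "y \<in> ball 0 (cmod a * R / 2)"
  \<comment> \<open>Midpoint of \<open>2 * cmod y / cmod a\<close> and \<open>R\<close>. Above the
    first number, the circle of radius \<open>s\<close> is mapped outside the open ball of radius
    \<open>cmod a / 2 * s\<close>, which contains \<open>y\<close>; below \<open>R\<close>, the
    closed disc stays in the domain of \<open>h\<close>.\<close>
  define s where "s = (2 * cmod y / cmod a + R) / 2"
  have "2 * cmod y / cmod a < R"
    using y \<open>a \<noteq> 0\<close> by (simp add: field_simps)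
  then have s: "2 * cmod y / cmod a < s" "s < R"
    by (auto simp: s_def)
  have s0: "s > 0"
    using s(1) by (meson divide_nonneg_nonneg le_less_trans mult_nonneg_nonneg norm_ge_zero zero_le_numeral)
  have sub: "cball 0 s \<subseteq> ball (0::complex) R"
    using s by auto
  have hol: "h holomorphic_on ball 0 R" and h0: "h 0 = 0"
    using h by (auto simp: near_linear_def)
  have "ball (h 0) (cmod a / 2 * s) \<subseteq> h ` ball 0 s"
  proof (rule ball_subset_open_map_image)
    show "continuous_on (closure (ball 0 s)) h"
      using hol sub s0 by (auto intro: holomorphic_on_imp_continuous_on holomorphic_on_subset)
    show "open (h ` interior (ball 0 s))"
      using hol sub near_linear_inj_on[OF assms]
      using holomorphic_on_subset[of h "ball 0 R" "ball 0 s"] inj_on_subset[of h "ball 0 R" "ball 0 s"]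
        subset_trans[OF ball_subset_cball sub]
      by (intro open_mapping_thm3) (simp_all add: interior_open)
    show "cmod a / 2 * s \<le> cmod (h z - h 0)" if "z \<in> frontier (ball 0 s)" for z
      using near_linear_bound(2)[OF h, of z] that s s0 h0 by auto
  qed (use s0 \<open>a \<noteq> 0\<close> in auto)
  moreover have "y \<in> ball (h 0) (cmod a / 2 * s)"
    using s(1) \<open>a \<noteq> 0\<close> h0 by (simp add: field_simps)
  ultimately show "y \<in> h ` ball 0 R"
    using sub by force
qed

text \<open>The inverse is controlled on a disc whose radius involves only \<open>a\<close> and
  \<open>R\<close>, so all maps with these constants have inverses on a common disc.\<close>

lemma near_linear_inv:
  assumes h: "near_linear a R h" and "a \<noteq> 0"
  defines "k \<equiv> inv_into (ball 0 R) h"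
  shows "\<And>y. y \<in> ball 0 (cmod a * R / 2) \<Longrightarrow> k y \<in> ball 0 R \<and> h (k y) = y \<and> cmod (k y) \<le> 2 / cmod a * cmod y"
    and "\<And>z. z \<in> ball 0 R \<Longrightarrow> k (h z) = z"
    and "k holomorphic_on ball 0 (cmod a * R / 2)"
proof -
  show 1: "k y \<in> ball 0 R \<and> h (k y) = y \<and> cmod (k y) \<le> 2 / cmod a * cmod y"
    if "y \<in> ball 0 (cmod a * R / 2)" for y
  proof -
    have "y \<in> h ` ball 0 R"
      using near_linear_image[OF assms(1,2)] that by auto
    then have *: "k y \<in> ball 0 R" "h (k y) = y"
      unfolding k_def by (rule inv_into_into, rule f_inv_into_f)
    then show ?thesis
      using near_linear_bound(2)[OF h *(1)] \<open>a \<noteq> 0\<close> by (simp add: field_simps)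
  qed
  show 2: "k (h z) = z" if "z \<in> ball 0 R" for z
    unfolding k_def using near_linear_inj_on[OF assms(1,2)] that by (rule inv_into_f_f)
  obtain g where g: "g holomorphic_on (h ` ball 0 R)" "\<And>z. z \<in> ball 0 R \<Longrightarrow> g (h z) = z"
    using holomorphic_has_inverse[of h "ball 0 R"] near_linear_inj_on[OF assms(1,2)] h
    unfolding near_linear_def by (metis open_ball)
  have "g holomorphic_on ball 0 (cmod a * R / 2)"
    using g(1) near_linear_image[OF assms(1,2)] by (rule holomorphic_on_subset)
  then show "k holomorphic_on ball 0 (cmod a * R / 2)"
    by (rule holomorphic_transform) (metis 1 g(2))
qed

text \<open>The quarter, instead of the half allowed in \<open>near_linear\<close>, leaves room for
  a perturbation. The radius \<open>2 * R\<close> leaves a margin \<open>R\<close> around each point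
  of \<open>ball 0 R\<close> for a Cauchy estimate.\<close>

lemma Diff0_deriv_bound:
  assumes "h \<in> Diff0"
  obtains R where "R > 0" "h holomorphic_on ball 0 (2 * R)"
    "\<And>z. z \<in> ball 0 R \<Longrightarrow> cmod (deriv h z - deriv h 0) \<le> cmod (deriv h 0) / 4"
proof -
  obtain r where r: "r > 0" "h holomorphic_on ball 0 r" and d: "deriv h 0 \<noteq> 0"
    using assms by (auto simp: Diff0_def)
  have "deriv h holomorphic_on ball 0 r"
    using r by (intro holomorphic_deriv) auto
  then have "isCont (deriv h) 0"
    using r by (meson centre_in_ball continuous_on_eq_continuous_at holomorphic_on_imp_continuous_on open_ball)
  then obtain s where s: "s > 0" "\<And>z. dist z 0 < s \<Longrightarrow> dist (deriv h z) (deriv h 0) < cmod (deriv h 0) / 4"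
    using d unfolding continuous_at_eps_delta
    by (metis divide_pos_pos zero_less_norm_iff zero_less_numeral)
  show ?thesis
  proof (rule that[of "min s (r / 2)"])
    show "h holomorphic_on ball 0 (2 * min s (r / 2))"
      using r(2) by (rule holomorphic_on_subset) auto
    show "cmod (deriv h z - deriv h 0) \<le> cmod (deriv h 0) / 4" if "z \<in> ball 0 (min s (r / 2))" for z
      using s(2)[of z] that by (simp add: dist_norm)
  qed (use r s in auto)
qed

lemma Diff0_near_linear:
  assumes "h \<in> Diff0"
  obtains R where "R > 0" "near_linear (deriv h 0) R h"
proof -
  obtain R where R: "R > 0" "h holomorphic_on ball 0 (2 * R)"
    "\<And>z. z \<in> ball 0 R \<Longrightarrow> cmod (deriv h z - deriv h 0) \<le> cmod (deriv h 0) / 4"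
    using Diff0_deriv_bound[OF assms] by blast
  have "h holomorphic_on ball 0 R"
    using R(2) by (rule holomorphic_on_subset) (use R in auto)
  moreover have "cmod (deriv h z - deriv h 0) \<le> cmod (deriv h 0) / 2" if "z \<in> ball 0 R" for z
    using R(3)[OF that] norm_ge_zero[of "deriv h 0"] by linarith
  ultimately show ?thesis
    using R that Diff0_0[OF assms] by (auto simp: near_linear_def)
qed

lemma near_linear_imp_Diff0:
  assumes "near_linear a R h" "a \<noteq> 0" "R > 0"
  shows "h \<in> Diff0"
proof -
  have "cmod (deriv h 0 - a) \<le> cmod a / 2"
    using assms by (auto simp: near_linear_def)
  then have "deriv h 0 \<noteq> 0"
    using \<open>a \<noteq> 0\<close> by auto
  then show ?thesis
    using assms by (auto simp: Diff0_def near_linear_def)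
qed

text \<open>The local inverse witnesses that the choice in \<open>germ_inv\<close> is meaningful;
  inserting \<open>h \<circ> ?k\<close>, which is the identity near 0, shows that whatever was
  chosen has the germ of the local inverse.\<close>

lemma germ_inv_near_linear:
  assumes h: "near_linear a R h" and a: "a \<noteq> 0" and R: "R > 0"
  shows "germ_eq (germ_inv h) (inv_into (ball 0 R) h)"
    and "germ_eq (germ_inv h \<circ> h) id" and "germ_eq (h \<circ> germ_inv h) id"
proof -
  let ?k = "inv_into (ball 0 R) h"
  have pos: "cmod a * R / 2 > 0"
    using a R by simp
  have 1: "germ_eq (?k \<circ> h) id"
    unfolding germ_eq_def using near_linear_inv(2)[OF h a] R by auto
  have hk: "germ_eq (h \<circ> ?k) id"
    unfolding germ_eq_def using near_linear_inv(1)[OF h a] pos by (intro exI[of _ "cmod a * R / 2"]) auto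
  show i: "germ_eq (germ_inv h \<circ> h) id" and "germ_eq (h \<circ> germ_inv h) id"
    unfolding germ_inv_def using someI[of "\<lambda>k. germ_eq (k \<circ> h) id \<and> germ_eq (h \<circ> k) id" ?k] 1 hk
    by auto
  have k0: "?k 0 = 0"
    using near_linear_inv(1)[OF h a, of 0] pos by simp
  have kc: "isCont ?k 0"
    using near_linear_inv(3)[OF h a] pos
    by (meson centre_in_ball continuous_on_eq_continuous_at holomorphic_on_imp_continuous_on open_ball)
  have "germ_eq (germ_inv h) (germ_inv h \<circ> (h \<circ> ?k))"
    using hk unfolding germ_eq_iff_eventually by eventually_elim simp
  also have "germ_eq (germ_inv h \<circ> (h \<circ> ?k)) ?k"
    using germ_eq_compose[OF i germ_eq_refl kc k0] by (simp add: comp_assoc)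
  finally show "germ_eq (germ_inv h) ?k" .
qed

lemma germ_inv:
  assumes "h \<in> Diff0"
  shows "germ_eq (germ_inv h \<circ> h) id" "germ_eq (h \<circ> germ_inv h) id" "germ_inv h \<in> Diff0"
proof -
  obtain R where R: "R > 0" "near_linear (deriv h 0) R h"
    using Diff0_near_linear[OF assms] .
  have a: "deriv h 0 \<noteq> 0"
    using assms by (simp add: Diff0_def)
  note gi = germ_inv_near_linear[OF R(2) a R(1)]
  show "germ_eq (germ_inv h \<circ> h) id" "germ_eq (h \<circ> germ_inv h) id"
    using gi by auto
  have "inv_into (ball 0 R) h analytic_on ball 0 (cmod (deriv h 0) * R / 2)"
    using near_linear_inv(3)[OF R(2) a] by (simp add: analytic_on_open)
  then have "inv_into (ball 0 R) h analytic_on {0}"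
    by (rule analytic_on_subset) (use a R in auto)
  then have an: "germ_inv h analytic_on {0}"
    using analytic_at_cong[of _ _ 0 0] gi(1) unfolding germ_eq_iff_eventually by blast
  have 0: "germ_inv h 0 = 0"
    using germ_eq_at_0[OF gi(2)] Diff0_0[OF assms] by simp
  \<comment> \<open>The chain rule at 0 makes the product of the two derivatives equal to 1, so the
    derivative of the inverse cannot vanish.\<close>
  have "deriv (germ_inv h \<circ> h) 0 = deriv id 0"
    by (rule deriv_cong_ev) (use gi(2) in \<open>simp_all add: germ_eq_iff_eventually\<close>)
  moreover have "deriv (germ_inv h \<circ> h) 0 = deriv (germ_inv h) 0 * deriv h 0"
    using assms an deriv_chain[of h 0 "germ_inv h"]
    by (auto simp: Diff0_iff analytic_on_imp_differentiable_at)
  ultimately show "germ_inv h \<in> Diff0"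
    using an 0 by (auto simp: Diff0_iff)
qed

lemma germ_inv_unique:
  assumes "u \<in> Diff0" "v \<in> Diff0" "germ_eq (u \<circ> v) id"
  shows "germ_eq (germ_inv u) v"
proof -
  have "germ_eq (germ_inv u) (germ_inv u \<circ> (u \<circ> v))"
    using assms(3) unfolding germ_eq_iff_eventually by eventually_elim simp
  also have "germ_eq (germ_inv u \<circ> (u \<circ> v)) v"
    using germ_eq_compose_Diff0[OF germ_inv(1)[OF assms(1)] germ_eq_refl assms(2)]
    by (simp add: comp_assoc)
  finally show ?thesis .
qed

section \<open>Words and syllables\<close>

text \<open>\<open>True\<close> marks a map applied as it stands (a power of \<open>f\<close>),
  \<open>False\<close> one that is conjugated by \<open>h\<close> (a power of \<open>g\<close>). The
  inverse \<open>k\<close> is a separate argument because both \<open>germ_inv h\<close> and the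
  explicit inverse on a disc are inserted for it.\<close>

fun syl_step :: "(complex \<Rightarrow> complex) \<Rightarrow> (complex \<Rightarrow> complex) \<Rightarrow> bool \<times> (complex \<Rightarrow> complex) \<Rightarrow> complex \<Rightarrow> complex" where
  "syl_step k h (b, \<phi>) = (if b then \<phi> else k \<circ> \<phi> \<circ> h)"

text \<open>As in \<open>eval_word\<close>, the head of the list acts last, so induction on the list
  prolongs an orbit by one point.\<close>

fun syl_eval :: "(complex \<Rightarrow> complex) \<Rightarrow> (complex \<Rightarrow> complex) \<Rightarrow> (bool \<times> (complex \<Rightarrow> complex)) list \<Rightarrow> complex \<Rightarrow> complex" where
  "syl_eval k h [] = id"
| "syl_eval k h (s # ss) = syl_step k h s \<circ> syl_eval k h ss"

definition alternating :: "(bool \<times> 'a) list \<Rightarrow> bool" where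
  "alternating = successively (\<lambda>s t. fst s \<noteq> fst t)"

definition nontrivial :: "(complex \<Rightarrow> complex) \<Rightarrow> bool" where
  "nontrivial \<phi> \<longleftrightarrow> \<phi> \<in> Diff0 \<and> \<not> germ_eq \<phi> id"

lemma alternating_simps [simp]:
  "alternating []" "alternating [s]"
  "alternating (s # t # ss) \<longleftrightarrow> fst s \<noteq> fst t \<and> alternating (t # ss)"
  by (simp_all add: alternating_def)

lemma syl_step_Diff0: "k \<in> Diff0 \<Longrightarrow> h \<in> Diff0 \<Longrightarrow> snd s \<in> Diff0 \<Longrightarrow> syl_step k h s \<in> Diff0"
  by (cases s) (auto intro!: Diff0_compose)

lemma syl_eval_Diff0:
  "k \<in> Diff0 \<Longrightarrow> h \<in> Diff0 \<Longrightarrow> (\<And>s. s \<in> set ss \<Longrightarrow> snd s \<in> Diff0) \<Longrightarrow> syl_eval k h ss \<in> Diff0"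
  by (induction ss) (auto intro!: Diff0_compose syl_step_Diff0)

text \<open>The inner factor \<open>h \<circ> germ_inv h\<close> cancels near 0.\<close>

lemma syl_step_compose:
  assumes h: "h \<in> Diff0" and "\<phi> \<in> Diff0" and psi: "\<psi> \<in> Diff0"
  shows "germ_eq (syl_step (germ_inv h) h (b, \<phi>) \<circ> syl_step (germ_inv h) h (b, \<psi>))
           (syl_step (germ_inv h) h (b, \<phi> \<circ> \<psi>))"
proof (cases b)
  case False
  have "germ_eq ((h \<circ> germ_inv h) \<circ> (\<psi> \<circ> h)) (id \<circ> (\<psi> \<circ> h))"
    by (intro germ_eq_compose_Diff0 germ_inv germ_eq_refl Diff0_compose assms)
  then have "germ_eq ((germ_inv h \<circ> \<phi>) \<circ> ((h \<circ> germ_inv h) \<circ> (\<psi> \<circ> h))) ((germ_inv h \<circ> \<phi>) \<circ> (id \<circ> (\<psi> \<circ> h)))"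
    by (rule germ_eq_compose_Diff0[OF germ_eq_refl]) (intro Diff0_compose germ_inv(3) assms)
  with False show ?thesis
    by (simp add: comp_assoc)
qed auto

lemma eval_letter_Diff0:
  "f \<in> Diff0 \<Longrightarrow> g \<in> Diff0 \<Longrightarrow> eval_letter f g l \<in> Diff0"
  by (auto simp: eval_letter_def Let_def germ_inv)

text \<open>The case with content is the inverse of the second generator: as germs, the inverse of a
  conjugate is the conjugate of the inverse, by uniqueness of inverses.\<close>

lemma eval_letter_conj:
  assumes h: "h \<in> Diff0" and g: "g \<in> Diff0"
  shows "germ_eq (eval_letter f (germ_inv h \<circ> g \<circ> h) l) (syl_step (germ_inv h) h (fst l, eval_letter f g l))"
proof (cases "l = (False, False)")
  case True
  have "germ_eq (syl_step (germ_inv h) h (False, g) \<circ> syl_step (germ_inv h) h (False, germ_inv g))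
           (syl_step (germ_inv h) h (False, g \<circ> germ_inv g))"
    by (intro syl_step_compose germ_inv assms)
  also have "germ_eq (germ_inv h \<circ> ((g \<circ> germ_inv g) \<circ> h)) (germ_inv h \<circ> (id \<circ> h))"
    by (intro germ_eq_compose_Diff0 germ_eq_refl germ_inv Diff0_compose assms)
  then have "germ_eq (syl_step (germ_inv h) h (False, g \<circ> germ_inv g)) (germ_inv h \<circ> h)"
    by (simp add: comp_assoc)
  also have "germ_eq (germ_inv h \<circ> h) id"
    by (intro germ_inv h)
  finally have "germ_eq ((germ_inv h \<circ> g \<circ> h) \<circ> (germ_inv h \<circ> germ_inv g \<circ> h)) id"
    by simp
  then have "germ_eq (germ_inv (germ_inv h \<circ> g \<circ> h)) (germ_inv h \<circ> germ_inv g \<circ> h)"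
    by (intro germ_inv_unique) (auto intro!: Diff0_compose germ_inv assms)
  with True show ?thesis
    by (simp add: eval_letter_def)
qed (cases l, auto simp: eval_letter_def)

text \<open>Cancelling from the middle, \<open>u ^^ n \<circ> germ_inv u ^^ n\<close> is the
  identity germ, so a trivial power of the inverse would make the same power of \<open>u\<close>
  trivial.\<close>

lemma infinite_order_germ_inv:
  assumes u: "u \<in> Diff0" and "infinite_order u"
  shows "infinite_order (germ_inv u)"
  unfolding infinite_order_def
proof (intro allI impI notI)
  fix n :: nat assume n: "n \<ge> 1" and triv: "germ_eq (germ_inv u ^^ n) id"
  have inv: "germ_eq (u ^^ m \<circ> germ_inv u ^^ m) id" for m
  proof (induction m)
    case (Suc m)
    have "germ_eq ((u \<circ> germ_inv u) \<circ> germ_inv u ^^ m) (id \<circ> germ_inv u ^^ m)"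
      by (intro germ_eq_compose_Diff0 germ_eq_refl germ_inv Diff0_funpow u)
    then have "germ_eq (u ^^ m \<circ> ((u \<circ> germ_inv u) \<circ> germ_inv u ^^ m)) (u ^^ m \<circ> (id \<circ> germ_inv u ^^ m))"
      by (rule germ_eq_compose_Diff0[OF germ_eq_refl]) (intro Diff0_compose Diff0_funpow germ_inv(3) u)
    then have "germ_eq (u ^^ Suc m \<circ> germ_inv u ^^ Suc m) (u ^^ m \<circ> germ_inv u ^^ m)"
      by (subst funpow_Suc_right) (simp add: comp_assoc)
    then show ?case
      using Suc.IH by (rule germ_eq_trans)
  qed simp
  have "germ_eq (u ^^ n \<circ> id) (u ^^ n \<circ> germ_inv u ^^ n)"
    by (intro germ_eq_compose_Diff0 germ_eq_refl germ_eq_sym[OF triv] Diff0_id)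
  also note inv
  finally show False
    using assms(2) n by (simp add: infinite_order_def)
qed

lemma infinite_order_eval_letter:
  "f \<in> Diff0 \<Longrightarrow> g \<in> Diff0 \<Longrightarrow> infinite_order f \<Longrightarrow> infinite_order g \<Longrightarrow> infinite_order (eval_letter f g l)"
  by (auto simp: eval_letter_def Let_def infinite_order_germ_inv)

lemma nontrivial_power:
  "u \<in> Diff0 \<Longrightarrow> infinite_order u \<Longrightarrow> n \<ge> 1 \<Longrightarrow> nontrivial (u ^^ n)"
  by (auto simp: nontrivial_def infinite_order_def Diff0_funpow)

text \<open>The leading syllable is kept as an explicit positive power of the first letter, inverse
  letters giving powers of the inverse germ. A new letter of the same generator is forced by
  reducedness to be the same letter and raises the exponent; a letter of the other generator opens a
  new syllable. The list is chosen before \<open>h\<close>, hence serves all conjugators.\<close>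

lemma word_syllables:
  assumes f: "f \<in> Diff0" "infinite_order f" and g: "g \<in> Diff0" "infinite_order g"
    and "reduced_word w" "w \<noteq> []"
  shows "\<exists>ss n. alternating ((fst (hd w), eval_letter f g (hd w) ^^ Suc n) # ss) \<and>
           (\<forall>s\<in>set ss. nontrivial (snd s)) \<and>
           (\<forall>h\<in>Diff0. germ_eq (eval_word f (germ_inv h \<circ> g \<circ> h) w)
              (syl_eval (germ_inv h) h ((fst (hd w), eval_letter f g (hd w) ^^ Suc n) # ss)))"
  using assms(5,6)
proof (induction w rule: reduced_word.induct)
  case (1 x y w)
  let ?u = "eval_letter f g"
  from 1 have yx: "y \<noteq> inverse_letter x" and "reduced_word (y # w)"
    by auto
  from 1(1)[OF this(2)] obtain ss n where alt: "alternating ((fst y, ?u y ^^ Suc n) # ss)"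
    and nt: "\<forall>s\<in>set ss. nontrivial (snd s)"
    and ev: "\<forall>h\<in>Diff0. germ_eq (eval_word f (germ_inv h \<circ> g \<circ> h) (y # w))
              (syl_eval (germ_inv h) h ((fst y, ?u y ^^ Suc n) # ss))"
    unfolding list.sel by blast
  have u: "?u l \<in> Diff0" "infinite_order (?u l)" for l
    using f g by (simp_all add: eval_letter_Diff0 infinite_order_eval_letter)
  have ss0: "snd s \<in> Diff0" if "s \<in> set ss" for s
    using nt that by (auto simp: nontrivial_def)
  have tail: "syl_eval (germ_inv h) h ss \<in> Diff0" if "h \<in> Diff0" for h
    by (intro syl_eval_Diff0 germ_inv that ss0)
  have full: "syl_eval (germ_inv h) h ((fst y, ?u y ^^ Suc n) # ss) \<in> Diff0" if "h \<in> Diff0" for h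
    by (intro syl_eval_Diff0 germ_inv that) (use ss0 in \<open>auto simp: Diff0_compose Diff0_funpow u\<close>)
  have step: "germ_eq (eval_word f (germ_inv h \<circ> g \<circ> h) (x # y # w))
      (syl_step (germ_inv h) h (fst x, ?u x) \<circ> syl_eval (germ_inv h) h ((fst y, ?u y ^^ Suc n) # ss))"
    if h: "h \<in> Diff0" for h
    unfolding eval_word.simps(2)[of _ _ x]
    using germ_eq_sym[OF germ_eq_compose_Diff0[OF germ_eq_sym[OF eval_letter_conj[OF h g(1)]] germ_eq_sym full[OF h]]] ev h by blast
  show ?case
  proof (cases "fst x = fst y")
    case True
    with yx have "x = y"
      by (cases x; cases y) (auto simp: inverse_letter_def)
    have "germ_eq (eval_word f (germ_inv h \<circ> g \<circ> h) (x # y # w))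
              (syl_eval (germ_inv h) h ((fst x, ?u x ^^ Suc (Suc n)) # ss))" if h: "h \<in> Diff0" for h
    proof -
      have "germ_eq ((syl_step (germ_inv h) h (fst x, ?u x) \<circ> syl_step (germ_inv h) h (fst x, ?u x ^^ Suc n)) \<circ> syl_eval (germ_inv h) h ss)
         (syl_step (germ_inv h) h (fst x, ?u x \<circ> ?u x ^^ Suc n) \<circ> syl_eval (germ_inv h) h ss)"
        by (intro germ_eq_compose_Diff0 syl_step_compose tail h u Diff0_funpow germ_eq_refl)
      with germ_eq_trans[OF step[OF h]] \<open>x = y\<close> show ?thesis
        by (simp add: comp_assoc)
    qed
    moreover have "alternating ((fst x, ?u x ^^ Suc (Suc n)) # ss)"
      using alt \<open>x = y\<close> by (cases ss) auto
    ultimately show ?thesis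
      using nt unfolding list.sel by blast
  next
    case False
    have "nontrivial (?u y ^^ Suc n)"
      by (intro nontrivial_power u) simp
    with nt have nt': "\<forall>s\<in>set ((fst y, ?u y ^^ Suc n) # ss). nontrivial (snd s)"
      by simp
    have eq: "syl_eval (germ_inv h) h ((fst x, ?u x ^^ Suc 0) # (fst y, ?u y ^^ Suc n) # ss) =
        syl_step (germ_inv h) h (fst x, ?u x) \<circ> syl_eval (germ_inv h) h ((fst y, ?u y ^^ Suc n) # ss)" for h
      by simp
    have "alternating ((fst x, ?u x ^^ Suc 0) # (fst y, ?u y ^^ Suc n) # ss)"
      using alt False by simp
    with nt' step[folded eq] show ?thesis
      unfolding list.sel by blast
  qed
next
  case ("2_2" x)
  have "germ_eq (eval_word f (germ_inv h \<circ> g \<circ> h) [x])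
      (syl_eval (germ_inv h) h [(fst x, eval_letter f g x ^^ Suc 0)])" if "h \<in> Diff0" for h
    using eval_letter_conj[OF that g(1), of f x] by simp
  moreover have "alternating [(fst x, eval_letter f g x ^^ Suc 0)]"
    by (rule alternating_simps)
  ultimately show ?case
    unfolding list.sel by (metis empty_iff list.set(1))
qed simp

lemma word_syllablesE:
  assumes "f \<in> Diff0" "infinite_order f" "g \<in> Diff0" "infinite_order g"
    and "reduced_word w" "w \<noteq> []"
  obtains ss where "ss \<noteq> []" "alternating ss" "\<And>s. s \<in> set ss \<Longrightarrow> nontrivial (snd s)"
    "\<And>h. h \<in> Diff0 \<Longrightarrow> germ_eq (eval_word f (germ_inv h \<circ> g \<circ> h) w) (syl_eval (germ_inv h) h ss)"
proof -
  have "nontrivial (eval_letter f g (hd w) ^^ Suc n)" for n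
    using assms by (intro nontrivial_power eval_letter_Diff0 infinite_order_eval_letter) auto
  with word_syllables[OF assms] that show ?thesis
    by (metis (no_types, lifting) list.distinct(1) set_ConsD snd_conv)
qed

section \<open>The analytic topology\<close>

text \<open>By the identity theorem the extension is unique on the disc, so the chosen one can be
  exchanged for any other. The strict bound on the supremum becomes a uniform bound \<open>e\<close>
  below \<open>\<epsilon>\<close>.\<close>

lemma anorm_less_iff:
  assumes r: "r > 0"
  shows "anorm r u < ereal \<epsilon> \<longleftrightarrow>
    (\<exists>H e. H holomorphic_on ball 0 r \<and> germ_eq H u \<and> e < \<epsilon> \<and> (\<forall>z\<in>ball 0 r. cmod (H z) \<le> e))"
proof (intro iffI; (elim exE conjE)?)
  assume less: "anorm r u < ereal \<epsilon>"
  define H where "H = (SOME H. extends_to r u H)"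
  have ex: "\<exists>H. extends_to r u H"
    using less unfolding anorm_def by (auto split: if_splits)
  then have H: "extends_to r u H"
    unfolding H_def by (rule someI_ex)
  have "(SUP z\<in>ball 0 r. ereal (cmod (H z))) < ereal \<epsilon>"
    using less ex by (simp add: anorm_def H_def)
  then obtain e where e: "(SUP z\<in>ball 0 r. ereal (cmod (H z))) < ereal e" "e < \<epsilon>"
    using ereal_dense2 by fastforce
  have "cmod (H z) \<le> e" if "z \<in> ball 0 r" for z
    using less_le_trans[OF le_less_trans[OF SUP_upper[OF that] e(1)] order_refl] by simp
  with H e(2) show "\<exists>H e. H holomorphic_on ball 0 r \<and> germ_eq H u \<and> e < \<epsilon> \<and> (\<forall>z\<in>ball 0 r. cmod (H z) \<le> e)"
    unfolding extends_to_def by blast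
next
  fix H e assume H: "H holomorphic_on ball 0 r" "germ_eq H u" and e: "e < \<epsilon>" "\<forall>z\<in>ball 0 r. cmod (H z) \<le> e"
  define H' where "H' = (SOME H. extends_to r u H)"
  have ex: "\<exists>H. extends_to r u H"
    using H by (auto simp: extends_to_def)
  then have H': "extends_to r u H'"
    unfolding H'_def by (rule someI_ex)
  have "germ_eq H' H"
    using H' germ_eq_trans[OF _ germ_eq_sym[OF H(2)]] by (auto simp: extends_to_def)
  then have "H' z = H z" if "z \<in> ball 0 r" for z
    using H' H(1) that by (auto simp: extends_to_def intro: germ_eq_imp_eq_on_ball)
  then have "(SUP z\<in>ball 0 r. ereal (cmod (H' z))) \<le> ereal e"
    using e(2) by (intro SUP_least) simp
  also have "\<dots> < ereal \<epsilon>"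
    using e(1) by simp
  finally show "anorm r u < ereal \<epsilon>"
    using ex by (simp add: anorm_def H'_def)
qed

lemma basic_open_iff:
  assumes "r > 0"
  shows "g \<in> basic_open f r \<epsilon> \<longleftrightarrow> g \<in> Diff0 \<and>
    (\<exists>H e. H holomorphic_on ball 0 r \<and> germ_eq H (\<lambda>z. g z - f z) \<and> e < \<epsilon> \<and> (\<forall>z\<in>ball 0 r. cmod (H z) \<le> e))"
  using anorm_less_iff[OF assms] by (simp add: basic_open_def)

lemma analytic_openI:
  assumes "U \<subseteq> Diff0" "\<And>h. h \<in> U \<Longrightarrow> \<exists>r>0. \<exists>\<epsilon>>0. basic_open h r \<epsilon> \<subseteq> U"
  shows "analytic_open U"
  unfolding analytic_open_def
proof (intro conjI ballI)
  fix h assume h: "h \<in> U"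
  then obtain r \<epsilon> where *: "r > 0" "\<epsilon> > 0" "basic_open h r \<epsilon> \<subseteq> U"
    using assms(2) by blast
  have "h \<in> basic_open h r \<epsilon>"
    unfolding basic_open_iff[OF *(1)] using h assms(1) *(2)
    by (auto intro!: exI[of _ "\<lambda>_. 0"] exI[of _ 0])
  with * h assms(1) show "\<exists>f\<in>Diff0. \<exists>r>0. \<exists>\<epsilon>>0. h \<in> basic_open f r \<epsilon> \<and> basic_open f r \<epsilon> \<subseteq> U"
    by blast
qed fact

text \<open>A basic open set containing \<open>h\<close> may be centred at another \<open>f\<close>,
  but its strict inequality leaves a slack \<open>\<epsilon> - d\<close>; perturbing
  \<open>h\<close> by less than this slack stays inside it.\<close>

lemma analytic_denseI:
  assumes "D \<subseteq> Diff0"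
    and "\<And>h r \<epsilon>. h \<in> Diff0 \<Longrightarrow> r > 0 \<Longrightarrow> \<epsilon> > 0 \<Longrightarrow>
      \<exists>u e. u holomorphic_on ball 0 r \<and> e < \<epsilon> \<and> (\<forall>z\<in>ball 0 r. cmod (u z) \<le> e) \<and> (\<lambda>z. h z + u z) \<in> D"
  shows "analytic_dense D"
  unfolding analytic_dense_def
proof (intro conjI allI impI; (elim conjE)?)
  fix V assume V: "analytic_open V" "V \<noteq> {}"
  then obtain h where h: "h \<in> V" "h \<in> Diff0"
    by (auto simp: analytic_open_def)
  then obtain f r \<epsilon> where r: "r > 0" and hf: "h \<in> basic_open f r \<epsilon>" "basic_open f r \<epsilon> \<subseteq> V"
    using V(1) unfolding analytic_open_def by blast
  obtain H d where H: "H holomorphic_on ball 0 r" "germ_eq H (\<lambda>z. h z - f z)" "d < \<epsilon>"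
    "\<forall>z\<in>ball 0 r. cmod (H z) \<le> d"
    using hf(1) unfolding basic_open_iff[OF r] by blast
  obtain u e where u: "u holomorphic_on ball 0 r" "e < \<epsilon> - d" "\<forall>z\<in>ball 0 r. cmod (u z) \<le> e"
    "(\<lambda>z. h z + u z) \<in> D"
    using assms(2)[OF h(2) r, of "\<epsilon> - d"] H(3) by auto
  have "(\<lambda>z. h z + u z) \<in> basic_open f r \<epsilon>"
    unfolding basic_open_iff[OF r]
  proof (intro conjI exI[of _ "\<lambda>z. H z + u z"] exI[of _ "d + e"])
    show "germ_eq (\<lambda>z. H z + u z) (\<lambda>z. h z + u z - f z)"
      using H(2) unfolding germ_eq_iff_eventually by eventually_elim simp
    show "\<forall>z\<in>ball 0 r. cmod (H z + u z) \<le> d + e"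
      using H(4) u(3) by (auto intro!: norm_triangle_mono)
  qed (use assms(1) u H in \<open>auto intro: holomorphic_on_add\<close>)
  then show "V \<inter> D \<noteq> {}"
    using hf(2) u(4) by blast
qed fact

lemma analytic_open_Diff0: "analytic_open Diff0"
proof (rule analytic_openI)
  fix h assume "h \<in> Diff0"
  show "\<exists>r>0. \<exists>\<epsilon>>0. basic_open h r \<epsilon> \<subseteq> Diff0"
    by (rule exI[of _ 1], rule conjI, simp, rule exI[of _ 1]) (auto simp: basic_open_def)
qed simp

lemma analytic_dense_Diff0: "analytic_dense Diff0"
  by (auto simp: analytic_dense_def analytic_open_def)

text \<open>Cauchy's estimate on the disc of radius \<open>R\<close> around \<open>z\<close> bounds
  \<open>deriv u z\<close> by \<open>cmod a / 4\<close>; together with the quarter in the hypothesis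
  on \<open>h\<close> this makes the half in \<open>near_linear\<close>.\<close>

lemma near_linear_perturb:
  assumes h: "h holomorphic_on ball 0 (2 * R)" "h 0 = 0" and R: "R > 0"
    and dh: "\<And>z. z \<in> ball 0 R \<Longrightarrow> cmod (deriv h z - a) \<le> cmod a / 4"
    and u: "u holomorphic_on ball 0 (2 * R)" "u 0 = 0" "\<And>z. z \<in> ball 0 (2 * R) \<Longrightarrow> cmod (u z) \<le> cmod a * R / 4"
  shows "near_linear a R (\<lambda>z. h z + u z)"
  unfolding near_linear_def
proof (intro conjI ballI)
  have sub: "ball (0::complex) R \<subseteq> ball 0 (2 * R)"
    using R by auto
  show "(\<lambda>z. h z + u z) holomorphic_on ball 0 R"
    using holomorphic_on_subset[OF h(1) sub] holomorphic_on_subset[OF u(1) sub] by (rule holomorphic_on_add)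
  fix z :: complex assume z: "z \<in> ball 0 R"
  have "cball z R \<subseteq> ball 0 (2 * R)"
  proof
    fix w assume "w \<in> cball z R"
    with z show "w \<in> ball 0 (2 * R)"
      using norm_triangle_ineq4[of z "z - w"] by (simp add: dist_norm)
  qed
  then have "cmod ((deriv ^^ 1) u z) \<le> fact 1 * (cmod a * R / 4) / R ^ 1"
    using u(3) R subset_trans[OF ball_subset_cball]
    by (intro Cauchy_inequality holomorphic_on_imp_continuous_on holomorphic_on_subset[OF u(1)])
       (auto simp: dist_norm subset_iff)
  then have du: "cmod (deriv u z) \<le> cmod a / 4"
    using R by simp
  have "z \<in> ball 0 (2 * R)"
    using z sub by blast
  then have "deriv (\<lambda>z. h z + u z) z = deriv h z + deriv u z"
    using h(1) u(1) by (intro deriv_add holomorphic_on_imp_differentiable_at) auto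
  then have eq: "deriv (\<lambda>z. h z + u z) z - a = (deriv h z - a) + deriv u z"
    by simp
  show "cmod (deriv (\<lambda>z. h z + u z) z - a) \<le> cmod a / 2"
    unfolding eq using norm_triangle_ineq[of "deriv h z - a" "deriv u z"] du dh[OF z] by linarith
qed (use h u in auto)

section \<open>Syllables on a common domain\<close>

text \<open>Quantitative form of a nontrivial germ on a prescribed disc. The last clause says that
  fixed points accumulate nowhere in the disc, which makes nontriviality usable away from 0.\<close>

definition tame :: "real \<Rightarrow> real \<Rightarrow> (complex \<Rightarrow> complex) \<Rightarrow> bool" where
  "tame \<rho> L \<phi> \<longleftrightarrow> \<phi> holomorphic_on ball 0 \<rho> \<and> inj_on \<phi> (ball 0 \<rho>) \<and>
     (\<forall>z\<in>ball 0 \<rho>. cmod (\<phi> z) \<le> L * cmod z \<and> (\<forall>\<^sub>F w in at z. \<phi> w \<noteq> w))"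

lemma tame_mono:
  assumes "tame \<rho> L \<phi>" "\<rho>' \<le> \<rho>" "L \<le> L'"
  shows "tame \<rho>' L' \<phi>"
proof -
  have sub: "ball (0::complex) \<rho>' \<subseteq> ball 0 \<rho>"
    using assms(2) by auto
  have "cmod (\<phi> z) \<le> L' * cmod z" if "z \<in> ball 0 \<rho>'" for z
    using assms(1,3) that sub mult_right_mono[OF assms(3) norm_ge_zero[of z]]
    unfolding tame_def by (meson order_trans subsetD)
  with assms(1) sub show ?thesis
    unfolding tame_def by (meson holomorphic_on_subset inj_on_subset subsetD)
qed

text \<open>The holomorphic function \<open>\<phi> z - z\<close> is not identically zero on the
  disc, so its zeros are isolated; the other clauses come from \<open>near_linear\<close>.\<close>

lemma nontrivial_imp_tame:
  assumes "nontrivial \<phi>"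
  obtains \<rho> L where "\<rho> > 0" "tame \<rho> L \<phi>"
proof -
  from assms have \<phi>: "\<phi> \<in> Diff0" and nid: "\<not> germ_eq \<phi> id"
    by (auto simp: nontrivial_def)
  obtain R where R: "R > 0" and nl: "near_linear (deriv \<phi> 0) R \<phi>"
    using Diff0_near_linear[OF \<phi>] .
  have a: "deriv \<phi> 0 \<noteq> 0"
    using \<phi> by (simp add: Diff0_def)
  obtain \<beta> where \<beta>: "\<beta> \<in> ball 0 R" "\<phi> \<beta> - \<beta> \<noteq> 0"
    using nid R by (auto simp: germ_eq_def)
  have hol: "(\<lambda>z. \<phi> z - z) holomorphic_on ball 0 R"
    using nl by (auto simp: near_linear_def intro!: holomorphic_intros)
  have "\<forall>\<^sub>F w in at z. \<phi> w \<noteq> w" if "z \<in> ball 0 R" for z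
    using non_zero_neighbour_alt[OF hol open_ball connected_ball that \<beta>]
    by (auto elim!: eventually_mono)
  then have "tame R (3 / 2 * cmod (deriv \<phi> 0)) \<phi>"
    using nl near_linear_bound(1)[OF nl] near_linear_inj_on[OF nl a]
    by (auto simp: tame_def near_linear_def)
  with R show ?thesis
    by (rule that)
qed

lemma nontrivial_list_tame:
  assumes "\<And>s. s \<in> set ss \<Longrightarrow> nontrivial (snd s)"
  obtains \<rho> L where "\<rho> > 0" "L \<ge> 1" "\<And>s. s \<in> set ss \<Longrightarrow> tame \<rho> L (snd s)"
  using assms
proof (induction ss arbitrary: thesis)
  case Nil
  show ?case by (rule Nil(1)[of 1 1]) auto
next
  case (Cons s ss)
  obtain \<rho> L where 1: "\<rho> > 0" "L \<ge> 1" "\<And>s. s \<in> set ss \<Longrightarrow> tame \<rho> L (snd s)"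
    using Cons.IH Cons.prems(2) by (metis list.set_intros(2))
  obtain \<rho>' L' where 2: "\<rho>' > 0" "tame \<rho>' L' (snd s)"
    using nontrivial_imp_tame Cons.prems(2) by (metis list.set_intros(1))
  show ?case
  proof (rule Cons.prems(1)[of "min \<rho> \<rho>'" "max L L'"])
    show "tame (min \<rho> \<rho>') (max L L') (snd t)" if "t \<in> set (s # ss)" for t
      using that 1(3)[THEN tame_mono, of t "min \<rho> \<rho>'" "max L L'"]
        tame_mono[OF 2(2), of "min \<rho> \<rho>'" "max L L'"] by auto
  qed (use 1 2 in auto)
qed

text \<open>The inequalities on \<open>\<sigma>\<close> allow any syllable to be evaluated on
  \<open>ball 0 \<sigma>\<close>: \<open>h\<close> maps this ball into \<open>ball 0 \<rho>\<close>,
  where the syllable maps are tame, and they send the result into the disc of radius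
  \<open>cmod a * R / 2\<close> on which the inverse of \<open>h\<close> is controlled.\<close>

locale common_domain =
  fixes a :: complex and R \<rho> L \<sigma> :: real
  assumes a: "a \<noteq> 0" and R: "R > 0" and L: "L \<ge> 1" and \<sigma>: "\<sigma> > 0" "\<sigma> \<le> \<rho>"
    "3 / 2 * cmod a * \<sigma> \<le> \<rho>" "3 * L * \<sigma> \<le> R"
begin

abbreviation loc_inv :: "(complex \<Rightarrow> complex) \<Rightarrow> complex \<Rightarrow> complex" where
  "loc_inv h \<equiv> inv_into (ball 0 R) h"

abbreviation step :: "(complex \<Rightarrow> complex) \<Rightarrow> bool \<times> (complex \<Rightarrow> complex) \<Rightarrow> complex \<Rightarrow> complex" where
  "step h \<equiv> syl_step (loc_inv h) h"

abbreviation ev :: "(complex \<Rightarrow> complex) \<Rightarrow> (bool \<times> (complex \<Rightarrow> complex)) list \<Rightarrow> complex \<Rightarrow> complex" where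
  "ev h \<equiv> syl_eval (loc_inv h) h"

lemma \<sigma>_le_R: "\<sigma> \<le> R"
proof -
  have "1 * \<sigma> \<le> 3 * L * \<sigma>"
    using L \<sigma>(1) by (intro mult_right_mono) auto
  with \<sigma>(4) show ?thesis by simp
qed

lemma domain:
  assumes h: "near_linear a R h" and \<phi>: "tame \<rho> L \<phi>" and z: "cmod z < \<sigma>"
  shows "z \<in> ball 0 R" "z \<in> ball 0 \<rho>" "h z \<in> ball 0 \<rho>" "\<phi> (h z) \<in> ball 0 (cmod a * R / 2)"
    and "cmod (\<phi> (h z)) \<le> L * (3 / 2 * cmod a * cmod z)"
proof -
  show zR: "z \<in> ball 0 R" "z \<in> ball 0 \<rho>"
    using z \<sigma>_le_R \<sigma>(2) by auto
  have hz: "cmod (h z) \<le> 3 / 2 * cmod a * cmod z"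
    using near_linear_bound[OF h zR(1)] by simp
  also have "\<dots> < 3 / 2 * cmod a * \<sigma>"
    using z a by simp
  finally show h\<rho>: "h z \<in> ball 0 \<rho>"
    using \<sigma>(3) by simp
  have "cmod (\<phi> (h z)) \<le> L * cmod (h z)"
    using \<phi> h\<rho> by (auto simp: tame_def)
  also have "\<dots> \<le> L * (3 / 2 * cmod a * cmod z)"
    using hz L by (intro mult_left_mono) auto
  finally show b: "cmod (\<phi> (h z)) \<le> L * (3 / 2 * cmod a * cmod z)" .
  also have "\<dots> < L * (3 / 2 * cmod a * \<sigma>)"
    using z a L by (intro mult_strict_left_mono) auto
  also have "\<dots> = (cmod a / 2) * (3 * L * \<sigma>)"
    by simp
  also have "\<dots> \<le> (cmod a / 2) * R"
    using \<sigma>(4) by (intro mult_left_mono) auto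
  finally show "\<phi> (h z) \<in> ball 0 (cmod a * R / 2)"
    by simp
qed

text \<open>The factor \<open>3 * L\<close> is the product of \<open>3 / 2 * cmod a\<close> for
  \<open>h\<close>, \<open>L\<close> for the syllable map and \<open>2 / cmod a\<close> for the
  inverse of \<open>h\<close>.\<close>

lemma step_bound:
  assumes h: "near_linear a R h" and s: "tame \<rho> L (snd s)" and z: "cmod z < \<sigma>"
  shows "cmod (step h s z) \<le> 3 * L * cmod z"
proof (cases s)
  case (Pair b \<phi>)
  with s have \<phi>: "tame \<rho> L \<phi>"
    by simp
  note d = domain[OF h \<phi> z]
  show ?thesis
  proof (cases b)
    case True
    have "cmod (\<phi> z) \<le> L * cmod z"
      using \<phi> d(2) by (auto simp: tame_def)
    also have "\<dots> \<le> 3 * L * cmod z"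
      using L by (intro mult_right_mono) auto
    finally show ?thesis
      using True Pair by simp
  next
    case False
    have "cmod (loc_inv h (\<phi> (h z))) \<le> 2 / cmod a * cmod (\<phi> (h z))"
      using near_linear_inv(1)[OF h a d(4)] by simp
    also have "\<dots> \<le> 2 / cmod a * (L * (3 / 2 * cmod a * cmod z))"
      using d(5) by (intro mult_left_mono) auto
    also have "\<dots> = 3 * L * cmod z"
      using a by (simp add: field_simps)
    finally show ?thesis
      using False Pair by simp
  qed
qed

text \<open>Eliminates the inverse, so that orbits under different conjugators can be compared
  through values of the conjugators alone.\<close>

lemma step_False_eq_iff:
  assumes h: "near_linear a R h" and \<phi>: "tame \<rho> L \<phi>" and z: "cmod z < \<sigma>" and v: "v \<in> ball 0 R"
  shows "step h (False, \<phi>) z = v \<longleftrightarrow> h v = \<phi> (h z)"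
  using near_linear_inv(1)[OF h a domain(4)[OF h \<phi> z]] near_linear_inv(2)[OF h a v] by auto

lemma step_holomorphic:
  assumes h: "near_linear a R h" and s: "tame \<rho> L (snd s)"
  shows "step h s holomorphic_on ball 0 \<sigma>"
proof (cases s)
  case (Pair b \<phi>)
  with s have \<phi>: "tame \<rho> L \<phi>"
    by simp
  have hol: "\<phi> holomorphic_on ball 0 \<rho>" "h holomorphic_on ball 0 R"
    using \<phi> h by (auto simp: tame_def near_linear_def)
  have "\<phi> holomorphic_on ball 0 \<sigma>"
    by (rule holomorphic_on_subset[OF hol(1)]) (use \<sigma>(2) in auto)
  moreover have "h holomorphic_on ball 0 \<sigma>"
    by (rule holomorphic_on_subset[OF hol(2)]) (use \<sigma>_le_R in auto)
  then have "\<phi> \<circ> h holomorphic_on ball 0 \<sigma>"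
    using domain(3)[OF h \<phi>] by (intro holomorphic_on_compose_gen[OF _ hol(1)]) auto
  then have "loc_inv h \<circ> (\<phi> \<circ> h) holomorphic_on ball 0 \<sigma>"
    using domain(4)[OF h \<phi>] by (intro holomorphic_on_compose_gen[OF _ near_linear_inv(3)[OF h a]]) auto
  ultimately show ?thesis
    using Pair by (simp add: comp_assoc)
qed

text \<open>Each step expands by at most \<open>3 * L\<close>, so the starting radius leaves room
  for \<open>N\<close> steps inside \<open>ball 0 \<sigma>\<close>. Keeping \<open>N\<close> apart
  from \<open>length ss\<close> fixes the starting disc during induction on the list.\<close>

lemma ev_bound:
  assumes "near_linear a R h" "\<And>s. s \<in> set ss \<Longrightarrow> tame \<rho> L (snd s)"
    and "length ss \<le> N" "cmod z < \<sigma> / (3 * L) ^ N"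
  shows "cmod (ev h ss z) \<le> (3 * L) ^ length ss * cmod z"
    and "length ss < N \<Longrightarrow> cmod (ev h ss z) < \<sigma>"
proof -
  have pow: "(3 * L) ^ n * cmod z < \<sigma>" if "n \<le> N" for n
  proof -
    have "(3 * L) ^ n * cmod z \<le> (3 * L) ^ N * cmod z"
      using that L by (intro mult_right_mono power_increasing) auto
    also have "\<dots> < \<sigma>"
      using assms(4) L by (simp add: field_simps)
    finally show ?thesis .
  qed
  show *: "cmod (ev h ss z) \<le> (3 * L) ^ length ss * cmod z"
    using assms(2,3)
  proof (induction ss)
    case (Cons s ss)
    then have IH: "cmod (ev h ss z) \<le> (3 * L) ^ length ss * cmod z"
      by simp
    also have "\<dots> < \<sigma>"
      using Cons.prems(2) by (intro pow) simp
    finally have "cmod (step h s (ev h ss z)) \<le> 3 * L * cmod (ev h ss z)"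
      using Cons.prems(1) by (intro step_bound assms(1)) auto
    also have "\<dots> \<le> 3 * L * ((3 * L) ^ length ss * cmod z)"
      using IH L by (intro mult_left_mono) auto
    finally show ?case
      by (simp add: mult_ac)
  qed simp
  show "cmod (ev h ss z) < \<sigma>"
    using * pow[OF assms(3)] by simp
qed

lemma ev_holomorphic:
  assumes h: "near_linear a R h" and "\<And>s. s \<in> set ss \<Longrightarrow> tame \<rho> L (snd s)" and "length ss \<le> N"
  shows "ev h ss holomorphic_on ball 0 (\<sigma> / (3 * L) ^ N)"
  using assms(2,3)
proof (induction ss)
  case (Cons s ss)
  then have 1: "ev h ss holomorphic_on ball 0 (\<sigma> / (3 * L) ^ N)"
    by simp
  have 2: "step h s holomorphic_on ball 0 \<sigma>"
    using Cons.prems(1) by (intro step_holomorphic h) simp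
  have "ev h ss ` ball 0 (\<sigma> / (3 * L) ^ N) \<subseteq> ball 0 \<sigma>"
    using ev_bound(2)[OF h, of ss N] Cons.prems by auto
  from holomorphic_on_compose_gen[OF 1 2 this] show ?case
    unfolding syl_eval.simps .
qed (auto intro: holomorphic_on_id)

lemma germ_eq_ev:
  assumes h: "near_linear a R h" and nt: "\<And>s. s \<in> set ss \<Longrightarrow> snd s \<in> Diff0"
  shows "germ_eq (syl_eval (germ_inv h) h ss) (ev h ss)"
  using nt
proof (induction ss)
  case (Cons s ss)
  obtain b \<phi> where s: "s = (b, \<phi>)"
    by (cases s)
  have hD: "h \<in> Diff0"
    using near_linear_imp_Diff0[OF h a R] .
  have "\<phi> \<in> Diff0"
    using Cons.prems[of s] s by simp
  then have "germ_eq (germ_inv h \<circ> (\<phi> \<circ> h)) (loc_inv h \<circ> (\<phi> \<circ> h))"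
    by (intro germ_eq_compose_Diff0 germ_inv_near_linear(1)[OF h a R] germ_eq_refl Diff0_compose hD)
  then have "germ_eq (syl_step (germ_inv h) h s) (step h s)"
    by (simp add: s comp_assoc)
  moreover have "germ_eq (syl_eval (germ_inv h) h ss) (ev h ss)"
    using Cons by simp
  moreover have "syl_eval (germ_inv h) h ss \<in> Diff0"
    using Cons.prems by (intro syl_eval_Diff0 germ_inv hD) simp
  ultimately show ?case
    unfolding syl_eval.simps by (rule germ_eq_compose_Diff0)
qed simp

end

text \<open>An injective map takes the value \<open>c\<close> at most once, so a punctured
  neighbourhood of \<open>z\<close> avoids it, even if \<open>F z = c\<close>.\<close>

lemma inj_on_eventually_ne:
  fixes F :: "complex \<Rightarrow> complex"
  assumes "inj_on F U" "open U" "z \<in> U"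
  shows "\<forall>\<^sub>F w in at z. F w \<noteq> c"
proof (cases "\<exists>t\<in>U. F t = c")
  case True
  then obtain t where t: "t \<in> U" "F t = c"
    by blast
  have "\<forall>\<^sub>F w in at z. w \<noteq> t"
    using tendsto_imp_eventually_ne[OF tendsto_ident_at, of z t UNIV] eventually_neq_at_within[of z z UNIV]
    by (cases "z = t") auto
  moreover have "\<forall>\<^sub>F w in at z. w \<in> U"
    using assms(2,3) by (rule eventually_at_in_open')
  ultimately show ?thesis
    by eventually_elim (use t assms(1) in \<open>auto dest: inj_onD\<close>)
next
  case False
  have "\<forall>\<^sub>F w in at z. w \<in> U"
    using assms(2,3) by (rule eventually_at_in_open')
  then show ?thesis
    by eventually_elim (use False in auto)
qed

section \<open>Orbits with pairwise distinct points\<close>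

context common_domain
begin

text \<open>The points visited before the current one, most recent first. The final 0 is included so
  that adding to \<open>h\<close> a function that vanishes on this list preserves
  \<open>h 0 = 0\<close>.\<close>

primrec past :: "(complex \<Rightarrow> complex) \<Rightarrow> complex \<Rightarrow> (bool \<times> (complex \<Rightarrow> complex)) list \<Rightarrow> complex list" where
  "past h p [] = [0]"
| "past h p (s # ss) = ev h ss p # past h p ss"

lemma zero_in_past: "0 \<in> set (past h p ss)"
  by (induction ss) auto

lemma start_in_past: "ss \<noteq> [] \<Longrightarrow> p \<in> set (past h p ss)"
proof (induction ss)
  case (Cons s ss)
  then show ?case
    by (cases ss) auto
qed simp

lemma past_bound:
  assumes "near_linear a R h" "\<And>s. s \<in> set ss \<Longrightarrow> tame \<rho> L (snd s)"
    and "length ss \<le> N" "cmod z < \<sigma> / (3 * L) ^ N" "x \<in> set (past h z ss)"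
  shows "cmod x < \<sigma>"
  using assms(2,3,5)
proof (induction ss)
  case (Cons s ss)
  have "cmod (ev h ss z) < \<sigma>"
    using Cons.prems by (intro ev_bound(2)[OF assms(1) _ _ assms(4)]) auto
  with Cons show ?case
    by auto
qed (use \<sigma> in auto)

text \<open>By \<open>step_False_eq_iff\<close> the point following \<open>?q\<close> is the
  solution \<open>v\<close> of \<open>h v = \<phi> (h ?q)\<close>. This equation involves
  \<open>h\<close> only at orbit points, where \<open>h'\<close> agrees with it, so \<open>v\<close>
  also follows \<open>?q\<close> under \<open>h'\<close>.\<close>

lemma ev_past_cong:
  assumes h: "near_linear a R h" and h': "near_linear a R h'"
    and tame: "\<And>s. s \<in> set ss \<Longrightarrow> tame \<rho> L (snd s)"
    and len: "length ss \<le> N" and p: "cmod p < \<sigma> / (3 * L) ^ N"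
    and eq: "\<And>x. x \<in> set (ev h ss p # past h p ss) \<Longrightarrow> h' x = h x"
  shows "ev h' ss p = ev h ss p \<and> past h' p ss = past h p ss"
  using tame len eq
proof (induction ss)
  case (Cons s ss)
  let ?q = "ev h ss p"
  have IH: "ev h' ss p = ?q \<and> past h' p ss = past h p ss"
    using Cons.prems by (intro Cons.IH) auto
  obtain b \<phi> where s: "s = (b, \<phi>)"
    by (cases s)
  have q: "cmod ?q < \<sigma>"
    using Cons.prems by (intro ev_bound(2)[OF h _ _ p]) auto
  have "step h' s ?q = step h s ?q"
  proof (cases b)
    case False
    have \<phi>: "tame \<rho> L \<phi>"
      using Cons.prems(1)[of s] s by simp
    have v: "step h s ?q \<in> ball 0 R" "h (step h s ?q) = \<phi> (h ?q)"
      using near_linear_inv(1)[OF h a domain(4)[OF h \<phi> q]] s False by simp_all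
    have "h' (step h s ?q) = h (step h s ?q)" "h' ?q = h ?q"
      using Cons.prems(3)[of "step h s ?q"] Cons.prems(3)[of ?q] by simp_all
    then show ?thesis
      using step_False_eq_iff[OF h' \<phi> q v(1)] v(2) s False by simp
  qed (simp add: s)
  with IH show ?case
    by simp
qed simp

text \<open>The parameter \<open>h\<close> enters the orbit of \<open>p\<close> only through its values on the orbit, so adding
  a multiple of a polynomial that vanishes at the earlier points moves the orbit only from its current
  point on. If the next syllable is \<open>\<phi>\<close>, the current point \<open>q\<close> itself is displaced; if it is
  \<open>h\<inverse> \<circ> \<phi> \<circ> h\<close>, then \<open>q\<close> stays and \<open>h q\<close> is displaced.\<close>
lemma exists_distinct_orbit:
  assumes C: "\<And>h. h \<in> C \<Longrightarrow> near_linear a R h"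
    and C_perturb: "\<And>h v. h \<in> C \<Longrightarrow> v holomorphic_on UNIV \<Longrightarrow> v 0 = 0 \<Longrightarrow>
      \<forall>\<^sub>F t in nhds 0. (\<lambda>z. h z + t * v z) \<in> C"
    and "C \<noteq> {}"
    and "alternating ss" "\<And>s. s \<in> set ss \<Longrightarrow> tame \<rho> L (snd s)" "length ss \<le> N"
  shows "\<exists>h\<in>C. \<exists>p. cmod p < \<sigma> / (3 * L) ^ N \<and> distinct (ev h ss p # past h p ss)"
  using assms(4-6)
proof (induction ss)
  case Nil
  \<comment> \<open>Any nonzero point of the disc would do, as the past consists of 0 alone.\<close>
  define p where "p = complex_of_real (\<sigma> / (3 * L) ^ N / 2)"
  have "\<sigma> / (3 * L) ^ N > 0"
    using \<sigma>(1) L by simp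
  then have "cmod p < \<sigma> / (3 * L) ^ N" "p \<noteq> 0"
    unfolding p_def norm_of_real using L by auto
  with \<open>C \<noteq> {}\<close> show ?case
    by auto
next
  case (Cons s ss)
  obtain b \<phi> where s: "s = (b, \<phi>)"
    by (cases s)
  have "alternating ss"
    using Cons.prems(1) by (cases ss) auto
  then obtain h p where h: "h \<in> C" and p: "cmod p < \<sigma> / (3 * L) ^ N"
    and dist: "distinct (ev h ss p # past h p ss)"
    using Cons.IH Cons.prems by auto
  define q where "q = ev h ss p"
  define Q where "Q = past h p ss"
  \<comment> \<open>A polynomial with zero set exactly \<open>set Q\<close>: adding a multiple of it
    to \<open>h\<close> keeps the values at all earlier points, 0 among them, and can change the
    value at \<open>q\<close>.\<close>
  define v where "v = (\<lambda>z. \<Prod>x\<in>set Q. (z - x))"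
  have nl: "near_linear a R h"
    using C h .
  have tame: "tame \<rho> L \<phi>" "\<And>s. s \<in> set ss \<Longrightarrow> tame \<rho> L (snd s)" and len: "length ss < N"
    using Cons.prems(2)[of s] Cons.prems s by auto
  have q\<sigma>: "cmod q < \<sigma>"
    unfolding q_def using len by (intro ev_bound(2)[OF nl tame(2) _ p]) auto
  have Q\<sigma>: "cmod x < \<sigma>" if "x \<in> set Q" for x
    using that len unfolding Q_def by (intro past_bound[OF nl tame(2) _ p]) auto
  have qQ: "q \<notin> set Q"
    using dist by (simp add: q_def Q_def)
  have v_hol: "v holomorphic_on UNIV"
    unfolding v_def by (intro holomorphic_intros)
  have v_Q: "v x = 0" if "x \<in> set Q" for x
    using that unfolding v_def by (intro prod_zero) auto
  have v_0: "v 0 = 0"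
    by (intro v_Q) (simp add: Q_def zero_in_past)
  have v_ne: "v z \<noteq> 0" if "z \<notin> set Q" for z
    using that by (auto simp: v_def)
  have qR: "q \<in> ball 0 R" and q\<rho>: "q \<in> ball 0 \<rho>" and hq\<rho>: "h q \<in> ball 0 \<rho>"
    using domain[OF nl tame(1) q\<sigma>] by blast+
  have \<phi>_inj: "inj_on \<phi> (ball 0 \<rho>)"
    using tame(1) by (simp add: tame_def)
  show ?case
  proof (cases b)
    case False
    define h' where "h' = (\<lambda>t z. h z + t * v z)"
    have lim: "filterlim (\<lambda>t. h q + t * v q) (at (h q)) (at 0)"
      using v_ne[OF qQ] by (auto simp: filterlim_at eventually_at_filter intro!: tendsto_eq_intros)
    \<comment> \<open>With \<open>w\<close> the new value at \<open>q\<close>, the next point equals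
      \<open>q\<close> iff \<open>\<phi> w = w\<close>, and equals an earlier \<open>x\<close> iff
      \<open>\<phi> w = h x\<close>. Both are excluded on a punctured neighbourhood of
      \<open>h q\<close>, which small nonzero \<open>t\<close> reach.\<close>
    have "\<forall>\<^sub>F w in at (h q). \<phi> w \<noteq> w"
      using tame(1) hq\<rho> by (auto simp: tame_def)
    moreover have "\<forall>\<^sub>F w in at (h q). \<forall>x\<in>set Q. \<phi> w \<noteq> h x"
      by (intro eventually_ball_finite ballI inj_on_eventually_ne[OF \<phi>_inj open_ball hq\<rho>]) auto
    ultimately have "\<forall>\<^sub>F w in at (h q). \<phi> w \<noteq> w \<and> (\<forall>x\<in>set Q. \<phi> w \<noteq> h x)"
      by eventually_elim simp
    then have "\<forall>\<^sub>F t in at 0. \<phi> (h' t q) \<noteq> h' t q \<and> (\<forall>x\<in>set Q. \<phi> (h' t q) \<noteq> h x)"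
      unfolding h'_def using lim by (rule eventually_compose_filterlim)
    moreover have "\<forall>\<^sub>F t in at 0. h' t \<in> C"
      unfolding h'_def using C_perturb[OF h v_hol v_0] eventually_nhds_conv_at by blast
    ultimately have "\<forall>\<^sub>F t in at 0. h' t \<in> C \<and> \<phi> (h' t q) \<noteq> h' t q \<and> (\<forall>x\<in>set Q. \<phi> (h' t q) \<noteq> h x)"
      by eventually_elim simp
    then obtain t where t: "h' t \<in> C" "\<phi> (h' t q) \<noteq> h' t q" "\<forall>x\<in>set Q. \<phi> (h' t q) \<noteq> h x"
      using eventually_happens'[OF at_neq_bot] by blast
    have nl': "near_linear a R (h' t)"
      using C t(1) .
    have h'_Q: "h' t x = h x" if "x \<in> set Q" for x
      using v_Q[OF that] by (simp add: h'_def)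
    \<comment> \<open>The value at \<open>q\<close> has changed, yet \<open>q\<close> remains the
      current point: by alternation the preceding syllable, if any, is unconjugated and produces
      \<open>q\<close> from an earlier point without using \<open>h\<close>.\<close>
    have same: "ev (h' t) ss p = q \<and> past (h' t) p ss = Q"
    proof (cases ss)
      case Nil
      then show ?thesis by (simp add: q_def Q_def)
    next
      case (Cons s' ss')
      then obtain \<psi> where s': "s' = (True, \<psi>)"
        using \<open>alternating (s # ss)\<close> s False by (cases s') auto
      have "ev (h' t) ss' p = ev h ss' p \<and> past (h' t) p ss' = past h p ss'"
        using Cons len tame(2) h'_Q
        by (intro ev_past_cong[OF nl nl' _ _ p]) (auto simp: Q_def)
      with Cons s' show ?thesis
        by (simp add: q_def Q_def)
    qed
    have "step (h' t) (False, \<phi>) q \<noteq> x" if "x \<in> insert q (set Q)" for x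
    proof -
      have "x \<in> ball 0 R"
        using that q\<sigma> Q\<sigma> \<sigma>_le_R by fastforce
      then show ?thesis
        using step_False_eq_iff[OF nl' tame(1) q\<sigma>, of x] that t(2,3) h'_Q by fastforce
    qed
    then have "step (h' t) (False, \<phi>) q \<notin> insert q (set Q)"
      by blast
    with same qQ dist t(1) p s False show ?thesis
      by (intro bexI[of _ "h' t"] exI[of _ p]) (simp_all add: Q_def)
  next
    case True
    \<comment> \<open>Here \<open>q\<close> has to move. The next three facts say that positions
      \<open>x\<close> close to but different from \<open>q\<close> are admissible: \<open>x\<close>
      is new, and so is its image under \<open>\<phi>\<close>.\<close>
    have ev1: "\<forall>\<^sub>F x in at q. \<phi> x \<noteq> x"
      using tame(1) q\<rho> by (auto simp: tame_def)
    have ev2: "\<forall>\<^sub>F x in at q. \<forall>y\<in>set Q. \<phi> x \<noteq> y"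
      by (intro eventually_ball_finite ballI inj_on_eventually_ne[OF \<phi>_inj open_ball q\<rho>]) auto
    have ev3: "\<forall>\<^sub>F x in at q. x \<in> - set Q"
      using qQ by (intro eventually_at_in_open') (auto simp: finite_imp_closed)
    show ?thesis
    proof (cases ss)
      case Nil
      \<comment> \<open>Without earlier syllables \<open>q\<close> is the starting point, which is
        moved directly while \<open>h\<close> is kept.\<close>
      have "\<forall>\<^sub>F x in at q. x \<in> ball 0 (\<sigma> / (3 * L) ^ N)"
        using p Nil by (intro eventually_at_in_open') (auto simp: q_def)
      with ev1 ev2 ev3 have "\<forall>\<^sub>F x in at q. x \<in> ball 0 (\<sigma> / (3 * L) ^ N) \<and>
          \<phi> x \<noteq> x \<and> (\<forall>y\<in>set Q. \<phi> x \<noteq> y) \<and> x \<in> - set Q"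
        by eventually_elim simp
      then obtain x where "x \<in> ball 0 (\<sigma> / (3 * L) ^ N)" "\<phi> x \<noteq> x" "\<forall>y\<in>set Q. \<phi> x \<noteq> y" "x \<in> - set Q"
        using eventually_happens'[OF at_neq_bot] by blast
      with Nil s True h show ?thesis
        by (intro bexI[of _ h] exI[of _ x]) (simp_all add: Q_def)
    next
      case (Cons s' ss')
      then obtain \<psi> where s': "s' = (False, \<psi>)"
        using \<open>alternating (s # ss)\<close> s True by (cases s') auto
      define q' where "q' = ev h ss' p"
      have \<psi>: "tame \<rho> L \<psi>"
        using tame(2)[of s'] Cons s' by simp
      have q'\<sigma>: "cmod q' < \<sigma>"
        unfolding q'_def using len Cons tame(2) by (intro ev_bound(2)[OF nl _ _ p]) auto
      have "step h (False, \<psi>) q' = q"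
        by (simp add: q_def q'_def Cons s')
      then have hq: "h q = \<psi> (h q')"
        using step_False_eq_iff[OF nl \<psi> q'\<sigma> qR] by simp
      have Q: "Q = q' # past h p ss'"
        by (simp add: Q_def Cons q'_def)
      \<comment> \<open>The coefficient for which the perturbed map takes at \<open>x\<close> the
        value that \<open>h\<close> takes at \<open>q\<close>. Since this value is
        \<open>\<psi> (h q')\<close>, the step from \<open>q'\<close> then lands at
        \<open>x\<close>; and \<open>c x\<close> tends to 0 as \<open>x\<close> tends to
        \<open>q\<close> because \<open>v q\<close> is nonzero.\<close>
      define c where "c = (\<lambda>x. (h q - h x) / v x)"
      define h' where "h' = (\<lambda>x z. h z + c x * v z)"
      have "isCont h q"
        using nl qR unfolding near_linear_def
        by (meson continuous_on_eq_continuous_at holomorphic_on_imp_continuous_on open_ball)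
      moreover have "isCont v q"
        unfolding v_def by (intro continuous_intros)
      ultimately have "(c \<longlongrightarrow> 0) (at q)"
        unfolding c_def isCont_def using v_ne[OF qQ] by (auto intro!: tendsto_eq_intros)
      then have "\<forall>\<^sub>F x in at q. h' x \<in> C"
        unfolding h'_def using C_perturb[OF h v_hol v_0] by (rule eventually_compose_filterlim[rotated])
      moreover have "\<forall>\<^sub>F x in at q. x \<in> ball 0 R"
        using qR by (intro eventually_at_in_open') auto
      ultimately have "\<forall>\<^sub>F x in at q. h' x \<in> C \<and> x \<in> ball 0 R \<and>
          \<phi> x \<noteq> x \<and> (\<forall>y\<in>set Q. \<phi> x \<noteq> y) \<and> x \<in> - set Q"
        using ev1 ev2 ev3 by eventually_elim simp
      then obtain x where x: "h' x \<in> C" "x \<in> ball 0 R"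
        "\<phi> x \<noteq> x" "\<forall>y\<in>set Q. \<phi> x \<noteq> y" "x \<in> - set Q"
        using eventually_happens'[OF at_neq_bot] by blast
      have nl': "near_linear a R (h' x)"
        using C x(1) .
      have h'_Q: "h' x y = h y" if "y \<in> set Q" for y
        using v_Q[OF that] by (simp add: h'_def)
      \<comment> \<open>The point \<open>q'\<close> and those before it lie in \<open>Q\<close>,
        where \<open>v\<close> vanishes, so this part of the orbit is unaffected.\<close>
      have same: "ev (h' x) ss' p = q' \<and> past (h' x) p ss' = past h p ss'"
        unfolding q'_def using Cons len tame(2) h'_Q
        by (intro ev_past_cong[OF nl nl' _ _ p]) (auto simp: Q q'_def)
      have "h' x x = h q"
        using v_ne[of x] x(5) by (simp add: h'_def c_def)
      then have "h' x x = \<psi> (h' x q')"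
        using hq h'_Q[of q'] by (simp add: Q)
      then have "step (h' x) (False, \<psi>) q' = x"
        using step_False_eq_iff[OF nl' \<psi> q'\<sigma> x(2)] by blast
      then have "ev (h' x) ss p = x" "past (h' x) p ss = Q"
        using same by (simp_all add: Cons s' Q)
      with x p dist s True show ?thesis
        by (intro bexI[of _ "h' x"] exI[of _ p]) (auto simp: Q_def)
    qed
  qed
qed

section \<open>Continuity of the evaluation in the conjugator\<close>

lemma near_linear_tendsto:
  assumes H: "\<And>n. near_linear a R (H n)" and lim: "\<And>z. z \<in> ball 0 R \<Longrightarrow> (\<lambda>n. H n z) \<longlonglongrightarrow> h z"
    and x: "\<And>n. x n \<in> ball 0 R" "y \<in> ball 0 R" "x \<longlonglongrightarrow> y"
  shows "(\<lambda>n. H n (x n)) \<longlonglongrightarrow> h y"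
proof -
  \<comment> \<open>All \<open>H n\<close> share one Lipschitz constant, so replacing
    \<open>x n\<close> by \<open>y\<close> costs a null sequence.\<close>
  have "(\<lambda>n. 3 / 2 * cmod a * cmod (x n - y)) \<longlonglongrightarrow> 0"
    using tendsto_mult_right_zero[OF tendsto_norm_zero[OF LIM_zero[OF x(3)]]] by blast
  then have "(\<lambda>n. H n (x n) - H n y) \<longlonglongrightarrow> 0"
    by (rule Lim_null_comparison[rotated]) (use near_linear_lipschitz(1)[OF H x(1,2)] in auto)
  from tendsto_add[OF this lim[OF x(2)]] show ?thesis
    by simp
qed

text \<open>The common lower Lipschitz bound estimates the distance of the preimages from
  \<open>z = loc_inv h y\<close> by that of \<open>x n\<close> from \<open>H n z\<close>, and both
  of the latter tend to \<open>y\<close>.\<close>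

lemma loc_inv_tendsto:
  assumes H: "\<And>n. near_linear a R (H n)" and h: "near_linear a R h"
    and lim: "\<And>z. z \<in> ball 0 R \<Longrightarrow> (\<lambda>n. H n z) \<longlonglongrightarrow> h z"
    and x: "\<And>n. x n \<in> ball 0 (cmod a * R / 2)" "y \<in> ball 0 (cmod a * R / 2)" "x \<longlonglongrightarrow> y"
  shows "(\<lambda>n. loc_inv (H n) (x n)) \<longlonglongrightarrow> loc_inv h y"
proof -
  define z where "z = loc_inv h y"
  have z: "z \<in> ball 0 R" "h z = y"
    using near_linear_inv(1)[OF h a x(2)] by (simp_all add: z_def)
  have bound: "cmod (loc_inv (H n) (x n) - z) \<le> 2 / cmod a * cmod (x n - H n z)" for n
  proof -
    have k: "loc_inv (H n) (x n) \<in> ball 0 R" "H n (loc_inv (H n) (x n)) = x n"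
      using near_linear_inv(1)[OF H a x(1)] by simp_all
    show ?thesis
      using near_linear_lipschitz(2)[OF H k(1) z(1), of n] a unfolding k(2) by (simp add: field_simps)
  qed
  have "(\<lambda>n. x n - H n z) \<longlonglongrightarrow> 0"
    using tendsto_diff[OF x(3) lim[OF z(1)]] z(2) by simp
  then have "(\<lambda>n. 2 / cmod a * cmod (x n - H n z)) \<longlonglongrightarrow> 0"
    by (intro tendsto_mult_right_zero tendsto_norm_zero)
  then have "(\<lambda>n. loc_inv (H n) (x n) - z) \<longlonglongrightarrow> 0"
    by (rule Lim_null_comparison[rotated]) (use bound in auto)
  then show ?thesis
    unfolding z_def by (rule LIM_zero_cancel)
qed

lemma ev_tendsto:
  assumes H: "\<And>n. near_linear a R (H n)" and h: "near_linear a R h"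
    and lim: "\<And>z. z \<in> ball 0 R \<Longrightarrow> (\<lambda>n. H n z) \<longlonglongrightarrow> h z"
    and "\<And>s. s \<in> set ss \<Longrightarrow> tame \<rho> L (snd s)" "length ss \<le> N" and p: "cmod p < \<sigma> / (3 * L) ^ N"
  shows "(\<lambda>n. ev (H n) ss p) \<longlonglongrightarrow> ev h ss p"
  using assms(4,5)
proof (induction ss)
  case (Cons s ss)
  obtain b \<phi> where s: "s = (b, \<phi>)"
    by (cases s)
  have \<phi>: "tame \<rho> L \<phi>" and tame: "\<And>s. s \<in> set ss \<Longrightarrow> tame \<rho> L (snd s)" and len: "length ss < N"
    using Cons.prems(1)[of s] Cons.prems s by auto
  have IH: "(\<lambda>n. ev (H n) ss p) \<longlonglongrightarrow> ev h ss p"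
    using Cons.IH tame len by simp
  have qn: "cmod (ev (H n) ss p) < \<sigma>" for n
    using len by (intro ev_bound(2)[OF H tame _ p]) auto
  have q: "cmod (ev h ss p) < \<sigma>"
    using len by (intro ev_bound(2)[OF h tame _ p]) auto
  have \<phi>_cont: "isCont \<phi> z" if "z \<in> ball 0 \<rho>" for z
    using \<phi> that unfolding tame_def
    by (meson continuous_on_eq_continuous_at holomorphic_on_imp_continuous_on open_ball)
  note dn = domain[OF H \<phi> qn] and d = domain[OF h \<phi> q]
  show ?case
  proof (cases b)
    case True
    with s isCont_tendsto_compose[OF \<phi>_cont[OF d(2)] IH] show ?thesis
      by simp
  next
    case False
    have "(\<lambda>n. H n (ev (H n) ss p)) \<longlonglongrightarrow> h (ev h ss p)"
      by (intro near_linear_tendsto[OF H lim] dn d IH)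
    then have "(\<lambda>n. \<phi> (H n (ev (H n) ss p))) \<longlonglongrightarrow> \<phi> (h (ev h ss p))"
      by (rule isCont_tendsto_compose[OF \<phi>_cont[OF d(3)]])
    then have "(\<lambda>n. loc_inv (H n) (\<phi> (H n (ev (H n) ss p)))) \<longlonglongrightarrow> loc_inv h (\<phi> (h (ev h ss p)))"
      by (intro loc_inv_tendsto[OF H h lim] dn d)
    with s False show ?thesis
      by simp
  qed
qed simp

end

section \<open>Generic conjugators\<close>

definition free_conj :: "(bool \<times> (complex \<Rightarrow> complex)) list \<Rightarrow> (complex \<Rightarrow> complex) set" where
  "free_conj ss = {h \<in> Diff0. \<not> germ_eq (syl_eval (germ_inv h) h ss) id}"

lemma germ_inv_cong:
  assumes "h \<in> Diff0" "germ_eq h h'"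
  shows "germ_eq (germ_inv h) (germ_inv h')"
proof (rule germ_inv_unique)
  have h': "h' \<in> Diff0"
    using assms by (rule Diff0_germ_eq)
  then show "germ_inv h' \<in> Diff0"
    by (rule germ_inv)
  have "germ_eq (h \<circ> germ_inv h') (h' \<circ> germ_inv h')"
    by (intro germ_eq_compose_Diff0 assms germ_eq_refl germ_inv h')
  then show "germ_eq (h \<circ> germ_inv h') id"
    using germ_inv(2)[OF h'] by (rule germ_eq_trans)
qed fact

lemma syl_eval_cong:
  assumes h: "h \<in> Diff0" "germ_eq h h'" and "\<And>s. s \<in> set ss \<Longrightarrow> snd s \<in> Diff0"
  shows "germ_eq (syl_eval (germ_inv h) h ss) (syl_eval (germ_inv h') h' ss)"
  using assms(3)
proof (induction ss)
  case (Cons s ss)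
  obtain b \<phi> where s: "s = (b, \<phi>)"
    by (cases s)
  have "\<phi> \<in> Diff0"
    using Cons.prems[of s] s by simp
  then have "germ_eq (germ_inv h \<circ> (\<phi> \<circ> h)) (germ_inv h' \<circ> (\<phi> \<circ> h'))"
    by (intro germ_eq_compose_Diff0 germ_inv_cong germ_eq_refl Diff0_compose h)
  then have "germ_eq (syl_step (germ_inv h) h s) (syl_step (germ_inv h') h' s)"
    by (simp add: s comp_assoc)
  moreover have "germ_eq (syl_eval (germ_inv h) h ss) (syl_eval (germ_inv h') h' ss)"
    using Cons by simp
  moreover have "syl_eval (germ_inv h) h ss \<in> Diff0"
    using Cons.prems by (intro syl_eval_Diff0 germ_inv h) simp
  ultimately show ?case
    unfolding syl_eval.simps by (rule germ_eq_compose_Diff0)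
qed simp

text \<open>Lets a member of a basic open set around \<open>h\<close> be replaced by
  \<open>h\<close> plus a holomorphic \<open>u\<close> on the whole disc, to which it is tied only
  as a germ.\<close>

lemma free_conj_germ_eq:
  assumes "h \<in> Diff0" "germ_eq h h'" "\<And>s. s \<in> set ss \<Longrightarrow> snd s \<in> Diff0" "h \<in> free_conj ss"
  shows "h' \<in> free_conj ss"
  using assms(4) syl_eval_cong[OF assms(1-3)] Diff0_germ_eq[OF assms(1,2)] germ_eq_trans
  unfolding free_conj_def by blast

lemma exists_common_domain:
  assumes "a \<noteq> 0" "R > 0" "\<And>s. s \<in> set ss \<Longrightarrow> nontrivial (snd s)"
  obtains \<rho> L \<sigma> where "common_domain a R \<rho> L \<sigma>" "\<And>s. s \<in> set ss \<Longrightarrow> tame \<rho> L (snd s)"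
proof -
  obtain \<rho> L where \<rho>: "\<rho> > 0" and L: "L \<ge> 1" and tame: "\<And>s. s \<in> set ss \<Longrightarrow> tame \<rho> L (snd s)"
    using nontrivial_list_tame[OF assms(3)] by blast
  \<comment> \<open>Each term of the minimum secures one of the upper bounds on
    \<open>\<sigma>\<close> in the locale.\<close>
  define \<sigma> where "\<sigma> = min \<rho> (min (\<rho> / (3 / 2 * cmod a)) (R / (3 * L)))"
  have "\<sigma> \<le> \<rho> / (3 / 2 * cmod a)" "\<sigma> \<le> R / (3 * L)" "\<sigma> \<le> \<rho>" "\<sigma> > 0"
    using assms(1,2) \<rho> L by (auto simp: \<sigma>_def)
  then have "common_domain a R \<rho> L \<sigma>"
    using assms(1,2) L by unfold_locales (auto simp: field_simps)
  with tame that show ?thesis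
    by blast
qed

text \<open>By the identity theorem the evaluated word is the identity germ iff it fixes the whole
  disc. The disc is independent of \<open>h\<close>, which allows comparing nearby conjugators at
  one point.\<close>

lemma (in common_domain) free_conj_iff:
  assumes h: "near_linear a R h" and nt: "\<And>s. s \<in> set ss \<Longrightarrow> nontrivial (snd s)"
    and tame: "\<And>s. s \<in> set ss \<Longrightarrow> tame \<rho> L (snd s)"
  shows "h \<in> free_conj ss \<longleftrightarrow> (\<exists>p. cmod p < \<sigma> / (3 * L) ^ length ss \<and> ev h ss p \<noteq> p)"
proof -
  have pos: "\<sigma> / (3 * L) ^ length ss > 0"
    using \<sigma>(1) L by simp
  have g: "germ_eq (syl_eval (germ_inv h) h ss) (ev h ss)"
    using nt by (intro germ_eq_ev[OF h]) (auto simp: nontrivial_def)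
  have "germ_eq (ev h ss) id \<longleftrightarrow> (\<forall>p\<in>ball 0 (\<sigma> / (3 * L) ^ length ss). ev h ss p = p)"
  proof
    assume "germ_eq (ev h ss) id"
    then show "\<forall>p\<in>ball 0 (\<sigma> / (3 * L) ^ length ss). ev h ss p = p"
      using germ_eq_imp_eq_on_ball[OF ev_holomorphic[OF h tame order_refl] holomorphic_on_id] by auto
  qed (use pos in \<open>auto simp: germ_eq_def\<close>)
  moreover have "germ_eq (syl_eval (germ_inv h) h ss) id \<longleftrightarrow> germ_eq (ev h ss) id"
    using g germ_eq_sym germ_eq_trans by blast
  ultimately show ?thesis
    using near_linear_imp_Diff0[OF h a R] by (auto simp: free_conj_def)
qed

text \<open>Argued by sequences: if ever smaller perturbations of \<open>h\<close> made the word
  trivial, each of them would fix a point \<open>p\<close> of the common disc that \<open>h\<close>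
  moves, and by \<open>ev_tendsto\<close> so would \<open>h\<close>.\<close>

lemma analytic_open_free_conj:
  assumes nt: "\<And>s. s \<in> set ss \<Longrightarrow> nontrivial (snd s)"
  shows "analytic_open (free_conj ss)"
proof (rule analytic_openI)
  fix h assume free: "h \<in> free_conj ss"
  then have hD: "h \<in> Diff0"
    by (simp add: free_conj_def)
  define a where "a = deriv h 0"
  have a: "a \<noteq> 0" and h0: "h 0 = 0"
    using hD by (simp_all add: a_def Diff0_def)
  obtain R where R: "R > 0" and h_hol: "h holomorphic_on ball 0 (2 * R)"
    and dh: "\<And>z. z \<in> ball 0 R \<Longrightarrow> cmod (deriv h z - a) \<le> cmod a / 4"
    using Diff0_deriv_bound[OF hD] unfolding a_def by blast
  obtain \<rho> L \<sigma> where "common_domain a R \<rho> L \<sigma>" and tame: "\<And>s. s \<in> set ss \<Longrightarrow> tame \<rho> L (snd s)"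
    using exists_common_domain[OF a R nt] by blast
  interpret common_domain a R \<rho> L \<sigma> by fact
  have R2: "2 * R > 0"
    using R by simp
  have pert: "near_linear a R (\<lambda>z. h z + u z)"
    if "u holomorphic_on ball 0 (2 * R)" "u 0 = 0" "\<And>z. z \<in> ball 0 (2 * R) \<Longrightarrow> cmod (u z) \<le> cmod a * R / 4" for u
    using near_linear_perturb[OF h_hol h0 R dh that] by simp
  have h: "near_linear a R h"
    using pert[of "\<lambda>_. 0"] R by simp
  obtain p where p: "cmod p < \<sigma> / (3 * L) ^ length ss" "ev h ss p \<noteq> p"
    using free free_conj_iff[OF h nt tame] by blast
  show "\<exists>r>0. \<exists>\<epsilon>>0. basic_open h r \<epsilon> \<subseteq> free_conj ss"
  proof (rule ccontr)
    assume none: "\<not> ?thesis"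
    \<comment> \<open>A null sequence that starts at the bound required in
      \<open>near_linear_perturb\<close>, so that all the perturbed maps share \<open>a\<close> and
      \<open>R\<close>.\<close>
    define \<epsilon> where "\<epsilon> = (\<lambda>n. cmod a * R / 4 * inverse (real (Suc n)))"
    have \<epsilon>_pos: "\<epsilon> n > 0" for n
      using a R by (simp add: \<epsilon>_def)
    have \<epsilon>_le: "\<epsilon> n \<le> cmod a * R / 4" for n
      using R unfolding \<epsilon>_def by (intro mult_left_le) (auto simp: field_simps)
    have "\<exists>u. u holomorphic_on ball 0 (2 * R) \<and> u 0 = 0 \<and> (\<forall>z\<in>ball 0 (2 * R). cmod (u z) \<le> \<epsilon> n) \<and>
        (\<lambda>z. h z + u z) \<notin> free_conj ss" for n
    proof -
      obtain g where g: "g \<in> basic_open h (2 * R) (\<epsilon> n)" "g \<notin> free_conj ss"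
        using none R2 \<epsilon>_pos by blast
      then have gD: "g \<in> Diff0"
        by (simp add: basic_open_def)
      obtain u e where u: "u holomorphic_on ball 0 (2 * R)" "germ_eq u (\<lambda>z. g z - h z)" "e < \<epsilon> n"
        "\<forall>z\<in>ball 0 (2 * R). cmod (u z) \<le> e"
        using g(1) unfolding basic_open_iff[OF R2] by blast
      have "germ_eq (\<lambda>z. h z + u z) g"
        using u(2) unfolding germ_eq_iff_eventually by eventually_elim simp
      moreover have "u 0 = 0"
        using germ_eq_at_0[OF u(2)] h0 Diff0_0[OF gD] by simp
      moreover have small: "cmod (u z) \<le> \<epsilon> n" if "z \<in> ball 0 (2 * R)" for z
        using u(3,4) that by fastforce
      moreover have "(\<lambda>z. h z + u z) \<in> Diff0"
        using pert[OF u(1) \<open>u 0 = 0\<close>] order_trans[OF small \<epsilon>_le] near_linear_imp_Diff0 a R by blast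
      ultimately show ?thesis
        using g(2) u(1) free_conj_germ_eq[of _ g ss] nt unfolding nontrivial_def by blast
    qed
    then obtain u where u: "\<And>n. u n holomorphic_on ball 0 (2 * R)" "\<And>n. u n 0 = 0"
      "\<And>n z. z \<in> ball 0 (2 * R) \<Longrightarrow> cmod (u n z) \<le> \<epsilon> n" "\<And>n. (\<lambda>z. h z + u n z) \<notin> free_conj ss"
      by metis
    have nl: "near_linear a R (\<lambda>z. h z + u n z)" for n
      using u(1,2) order_trans[OF u(3) \<epsilon>_le] by (rule pert)
    have "\<epsilon> \<longlonglongrightarrow> 0"
      unfolding \<epsilon>_def by (intro tendsto_mult_right_zero LIMSEQ_inverse_real_of_nat)
    have "(\<lambda>n. h z + u n z) \<longlonglongrightarrow> h z" if "z \<in> ball 0 R" for z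
    proof -
      have "(\<lambda>n. u n z) \<longlonglongrightarrow> 0"
        using \<open>\<epsilon> \<longlonglongrightarrow> 0\<close> by (rule Lim_null_comparison[rotated]) (use u(3)[of z] that R in auto)
      from tendsto_add[OF tendsto_const[of "h z"] this] show ?thesis
        by simp
    qed
    then have "(\<lambda>n. ev (\<lambda>z. h z + u n z) ss p) \<longlonglongrightarrow> ev h ss p"
      by (rule ev_tendsto[OF nl h _ tame order_refl p(1)])
    moreover have "ev (\<lambda>z. h z + u n z) ss p = p" for n
      using u(4)[of n] p(1) free_conj_iff[OF nl nt tame] by blast
    ultimately show False
      using p(2) by (simp add: LIMSEQ_const_iff)
  qed
qed (auto simp: free_conj_def)

text \<open>A nearby conjugator with a distinct orbit has an end point different from the starting
  point, so its word moves a point of the common disc.\<close>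

lemma analytic_dense_free_conj:
  assumes nt: "\<And>s. s \<in> set ss \<Longrightarrow> nontrivial (snd s)" and "alternating ss" "ss \<noteq> []"
  shows "analytic_dense (free_conj ss)"
proof (rule analytic_denseI)
  fix h :: "complex \<Rightarrow> complex" and r \<epsilon> :: real
  assume hD: "h \<in> Diff0" and r: "r > 0" and \<epsilon>: "\<epsilon> > 0"
  define a where "a = deriv h 0"
  have a: "a \<noteq> 0" and h0: "h 0 = 0"
    using hD by (simp_all add: a_def Diff0_def)
  obtain R where R: "R > 0" and h_hol: "h holomorphic_on ball 0 (2 * R)"
    and dh: "\<And>z. z \<in> ball 0 R \<Longrightarrow> cmod (deriv h z - a) \<le> cmod a / 4"
    using Diff0_deriv_bound[OF hD] unfolding a_def by blast
  obtain \<rho> L \<sigma> where "common_domain a R \<rho> L \<sigma>" and tame: "\<And>s. s \<in> set ss \<Longrightarrow> tame \<rho> L (snd s)"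
    using exists_common_domain[OF a R nt] by blast
  interpret common_domain a R \<rho> L \<sigma> by fact
  \<comment> \<open>Smallness on the larger disc with the smaller bound serves two purposes at once:
    closeness in the topology and the constants \<open>a\<close>, \<open>R\<close> of
    \<open>near_linear\<close>.\<close>
  define r' \<eta> where "r' = max r (2 * R)" and "\<eta> = min \<epsilon> (cmod a * R / 4)"
  have \<eta>: "\<eta> > 0"
    using a R \<epsilon> by (simp add: \<eta>_def)
  \<comment> \<open>The strict inequality \<open>e < \<eta>\<close> makes the family stable under
    adding small multiples of any entire function vanishing at 0.\<close>
  define C where "C = {(\<lambda>z. h z + u z) | u. u holomorphic_on UNIV \<and> u 0 = 0 \<and> (\<exists>e<\<eta>. \<forall>z\<in>ball 0 r'. cmod (u z) \<le> e)}"
  have C_nl: "near_linear a R k" if "k \<in> C" for k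
  proof -
    obtain u e where u: "k = (\<lambda>z. h z + u z)" "u holomorphic_on UNIV" "u 0 = 0" "e < \<eta>"
      "\<forall>z\<in>ball 0 r'. cmod (u z) \<le> e"
      using \<open>k \<in> C\<close> by (auto simp: C_def)
    have "cmod (u z) \<le> cmod a * R / 4" if "z \<in> ball 0 (2 * R)" for z
    proof -
      have "cmod (u z) \<le> e"
        using u(5) that by (auto simp: r'_def)
      with u(4) show ?thesis
        by (simp add: \<eta>_def)
    qed
    then show ?thesis
      unfolding u(1) using u(2,3)
      by (intro near_linear_perturb[OF h_hol h0 R dh]) (auto intro: holomorphic_on_subset)
  qed
  have C_perturb: "\<forall>\<^sub>F t in nhds 0. (\<lambda>z. k z + t * v z) \<in> C"
    if k: "k \<in> C" and v: "v holomorphic_on UNIV" "v 0 = 0" for k v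
  proof -
    obtain u e where u: "k = (\<lambda>z. h z + u z)" "u holomorphic_on UNIV" "u 0 = 0" "e < \<eta>"
      "\<forall>z\<in>ball 0 r'. cmod (u z) \<le> e"
      using k by (auto simp: C_def)
    have "compact (v ` cball 0 r')"
      using v(1) by (intro compact_continuous_image compact_cball)
        (auto intro: holomorphic_on_imp_continuous_on holomorphic_on_subset)
    then obtain B where B: "B > 0" "\<And>z. z \<in> ball 0 r' \<Longrightarrow> cmod (v z) \<le> B"
      using compact_imp_bounded[of "v ` cball 0 r'"] bounded_pos[of "v ` cball 0 r'"] by auto
    have "((\<lambda>t. e + cmod t * B) \<longlongrightarrow> e + cmod 0 * B) (nhds 0)"
      by (intro tendsto_intros filterlim_ident)
    then have "\<forall>\<^sub>F t in nhds 0. e + cmod t * B < \<eta>"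
      by (rule order_tendstoD) (use u(4) in simp)
    then show ?thesis
    proof eventually_elim
      case (elim t)
      have "cmod (u z + t * v z) \<le> e + cmod t * B" if "z \<in> ball 0 r'" for z
        using u(5) B(2)[OF that] that by (intro norm_triangle_mono) (auto simp: norm_mult mult_left_mono)
      with elim have "\<exists>e<\<eta>. \<forall>z\<in>ball 0 r'. cmod (u z + t * v z) \<le> e"
        by blast
      moreover have "(\<lambda>z. u z + t * v z) holomorphic_on UNIV"
        using u(2) v(1) by (intro holomorphic_intros)
      ultimately show ?case
        unfolding C_def u(1) using u(3) v(2)
        by (intro CollectI exI[of _ "\<lambda>z. u z + t * v z"]) (auto simp: add.assoc)
    qed
  qed
  have "h \<in> C"
    unfolding C_def using \<eta> by (intro CollectI exI[of _ "\<lambda>_. 0"]) (auto intro: exI[of _ 0])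
  then have "C \<noteq> {}"
    by blast
  obtain k p where k: "k \<in> C" and p: "cmod p < \<sigma> / (3 * L) ^ length ss" and "distinct (ev k ss p # past k p ss)"
    using exists_distinct_orbit[OF C_nl C_perturb \<open>C \<noteq> {}\<close> assms(2) tame order_refl] by blast
  then have "ev k ss p \<noteq> p"
    using start_in_past[OF \<open>ss \<noteq> []\<close>] by auto
  then have free: "k \<in> free_conj ss"
    using free_conj_iff[OF C_nl[OF k] nt tame] p by blast
  obtain u e where u: "k = (\<lambda>z. h z + u z)" "u holomorphic_on UNIV" "e < \<eta>"
    "\<forall>z\<in>ball 0 r'. cmod (u z) \<le> e"
    using k by (auto simp: C_def)
  show "\<exists>u e. u holomorphic_on ball 0 r \<and> e < \<epsilon> \<and> (\<forall>z\<in>ball 0 r. cmod (u z) \<le> e) \<and> (\<lambda>z. h z + u z) \<in> free_conj ss"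
  proof (intro exI conjI)
    show "u holomorphic_on ball 0 r"
      using u(2) by (rule holomorphic_on_subset) simp
    show "\<forall>z\<in>ball 0 r. cmod (u z) \<le> e"
      using u(4) by (auto simp: r'_def)
  qed (use u(1,3) free \<eta>_def in auto)
qed (auto simp: free_conj_def)

theorem theorem4p1:
  fixes f g :: "complex \<Rightarrow> complex"
  assumes "f \<in> Diff0" and "g \<in> Diff0"
    and "infinite_order f" and "infinite_order g"
  shows "\<exists>H \<subseteq> Diff0. Gdelta_dense H \<and>
           (\<forall>h\<in>H. \<forall>w. w \<noteq> [] \<and> reduced_word w \<longrightarrow>
              \<not> germ_eq (eval_word f (germ_inv h \<circ> g \<circ> h) w) id)"
proof -
  \<comment> \<open>For words that are empty or not reduced the condition is void and the set is all
    of \<open>Diff0\<close>, so the index may range over all lists of letters.\<close>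
  define U where "U = (\<lambda>w. {h \<in> Diff0. w \<noteq> [] \<and> reduced_word w \<longrightarrow>
      \<not> germ_eq (eval_word f (germ_inv h \<circ> g \<circ> h) w) id})"
  have U: "analytic_open (U w) \<and> analytic_dense (U w)" for w
  proof (cases "w \<noteq> [] \<and> reduced_word w")
    case True
    then obtain ss where ss: "ss \<noteq> []" "alternating ss" "\<And>s. s \<in> set ss \<Longrightarrow> nontrivial (snd s)"
      and "\<And>h. h \<in> Diff0 \<Longrightarrow> germ_eq (eval_word f (germ_inv h \<circ> g \<circ> h) w) (syl_eval (germ_inv h) h ss)"
      using word_syllablesE[OF assms(1,3,2,4)] by blast
    then have "germ_eq (eval_word f (germ_inv h \<circ> g \<circ> h) w) id \<longleftrightarrow> germ_eq (syl_eval (germ_inv h) h ss) id"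
      if "h \<in> Diff0" for h
      using that germ_eq_sym germ_eq_trans by blast
    then have "U w = free_conj ss"
      using True by (auto simp: U_def free_conj_def)
    then show ?thesis
      using ss by (simp add: analytic_open_free_conj analytic_dense_free_conj)
  next
    case False
    then have "U w = Diff0"
      by (auto simp: U_def)
    then show ?thesis
      by (simp add: analytic_open_Diff0 analytic_dense_Diff0)
  qed
  \<comment> \<open>Lists of letters form a countable type, and \<open>from_nat\<close> reaches each
    of them.\<close>
  define H where "H = (\<Inter>n. U (from_nat n))"
  have H: "h \<in> U w" if "h \<in> H" for h w
    using that unfolding H_def by (metis INT_E UNIV_I from_nat_to_nat)
  have "Gdelta_dense H"
    unfolding Gdelta_dense_def H_def
    by (rule exI[of _ "\<lambda>n. U (from_nat n)"]) (simp add: U)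
  moreover have "H \<subseteq> Diff0"
    using H by (auto simp: U_def)
  ultimately show ?thesis
    using H by (intro exI[of _ H]) (auto simp: U_def)
qed

end
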